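(* Let $\Bbbk$ be a field of characteristic $p\ge 3$ and let $(A,\cdot,\{-,-\},(-)^{\{p\}})$ be a weakly restricted Poisson algebra over $\Bbbk$. Then the following two conditions (two definitions of a restricted Poisson algebra) are equivalent: (i) $(x^2)^{\{p\}}=2x^p x^{\{p\}}$ for all $x\in A$; (ii) (Bezrukavnikov–Kaledin) $(xy)^{\{p\}}=x^p y^{\{p\}}+y^p x^{\{p\}}+P(x,y)$ for all $x,y\in A$, where $P(x,y)$ is the canonical quantized polynomial.
   Context: All algebras are over $\Bbbk$, of characteristic $p\ge 3$. A Poisson algebra is a commutative associative algebra $A$ with a Lie bracket $\{-,-\}$ satisfying $\{xy,z\}=x\{y,z\}+y\{x,z\}$. A restricted Lie algebra is a Lie algebra $L$ with a map ($p$-map) $x\mapsto x^{[p]}$ such that, with $\mathrm{ad}_x(y)=[x,y]$: (1) $\mathrm{ad}_x^p=\mathrm{ad}_{x^{[p]}}$; (2) $(\lambda x)^{[p]}=\lambda^p x^{[p]}$ for $\lambda\in\Bbbk$; (3) $(x+y)^{[p]}=x^{[p]}+y^{[p]}+\Lambda_p(x,y)$, where $\Lambda_p(x,y)=\sum_{i=1}^{p-1}\frac{s_i(x,y)}{i}$ and $s_i(x,y)$ is the coefficient of $t^{i-1}$ in the formal expression $\mathrm{ad}_{tx+y}^{p-1}(x)$. A weakly restricted Poisson algebra is a Poisson algebra $A$ with a map $(-)^{\{p\}}:A\to A$ such that $(A,\{-,-\},(-)^{\{p\}})$ is a restricted Lie algebra. The polynomial $P(x,y)$: let $V=\Bbbk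 x\oplus\Bbbk y$, let $Lie(V)$ be the free Lie algebra on $V$, and regard the tensor algebra $T(V)$ as the universal enveloping algebra of $Lie(V)$, with Poincaré–Birkhoff–Witt filtration $F_nT(V)=\Bbbk\oplus Lie(V)\oplus\cdots\oplus Lie(V)^{n}$ (the span of products of at most $n$ elements of $Lie(V)$). Its associated graded algebra is the free Poisson algebra $FP(V)=\mathrm{Sym}(Lie(V))$ (the symmetric algebra with the Poisson bracket extending the Lie bracket of $Lie(V)$). The element $(xy)^p-x^py^p\in T(V)$ lies in $F_{p+1}T(V)$, and $P(x,y)$ is its class in $F_{p+1}T(V)/F_pT(V)\cong\mathrm{Sym}^{p+1}(Lie(V))\subset FP(V)$. For elements $x,y$ of a Poisson algebra $A$, $P(x,y)\in A$ is the image of this element under the unique Poisson algebra morphism $FP(V)\to A$ sending the generators to the given $x,y$. *)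

theory Defs
  imports
    "HOL-Library.Poly_Mapping"
    "HOL-Computational_Algebra.Computational_Algebra"
begin

section \<open>Restricted Lie algebras and Poisson algebras\<close>

locale lie_algebra = vector_space scale
  for scale :: "'k::field \<Rightarrow> 'a::ab_group_add \<Rightarrow> 'a" +
  fixes bracket :: "'a \<Rightarrow> 'a \<Rightarrow> 'a"
  assumes bracket_add_left: "bracket (x + y) z = bracket x z + bracket y z"
    and bracket_add_right: "bracket x (y + z) = bracket x y + bracket x z"
    and bracket_scale_left: "bracket (scale c x) y = scale c (bracket x y)"
    and bracket_scale_right: "bracket x (scale c y) = scale c (bracket x y)"
    and bracket_self: "bracket x x = 0"
    and jacobi: "bracket x (bracket y z) + bracket y (bracket z x) + bracket z (bracket x y) = 0"

text \<open>
  Elements of \<open>L[t]\<close> are represented by \<^typ>\<open>'a poly\<close>, which only needs the additive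
  structure of \<open>L\<close>; the following is the operator \<open>ad\<close> of \<open>t x + y\<close> on \<open>L[t]\<close>.
\<close>

definition ad_pencil :: "('a \<Rightarrow> 'a \<Rightarrow> 'a) \<Rightarrow> 'a \<Rightarrow> 'a \<Rightarrow> 'a::ab_group_add poly \<Rightarrow> 'a poly" where
  "ad_pencil bracket x y f = pCons 0 (map_poly (bracket x) f) + map_poly (bracket y) f"

definition jacobson_s :: "nat \<Rightarrow> ('a \<Rightarrow> 'a \<Rightarrow> 'a) \<Rightarrow> nat \<Rightarrow> 'a \<Rightarrow> 'a \<Rightarrow> 'a::ab_group_add" where
  "jacobson_s p bracket i x y = coeff ((ad_pencil bracket x y ^^ (p - 1)) [:x:]) (i - 1)"

definition jacobson_Lambda ::
    "nat \<Rightarrow> ('k::field \<Rightarrow> 'a \<Rightarrow> 'a) \<Rightarrow> ('a \<Rightarrow> 'a \<Rightarrow> 'a) \<Rightarrow> 'a \<Rightarrow> 'a \<Rightarrow> 'a::ab_group_add" where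
  "jacobson_Lambda p scale bracket x y =
     (\<Sum>i = 1..p - 1. scale (inverse (of_nat i)) (jacobson_s p bracket i x y))"

locale restricted_lie_algebra = lie_algebra scale bracket
  for scale :: "'k::field \<Rightarrow> 'a::ab_group_add \<Rightarrow> 'a"
    and bracket :: "'a \<Rightarrow> 'a \<Rightarrow> 'a" +
  fixes p :: nat and pmap :: "'a \<Rightarrow> 'a"
  assumes ad_pow: "(bracket x ^^ p) = bracket (pmap x)"
    and pmap_scale: "pmap (scale c x) = scale (c ^ p) (pmap x)"
    and pmap_add: "pmap (x + y) = pmap x + pmap y + jacobson_Lambda p scale bracket x y"

text \<open>
  Algebras are unital. The sort \<open>{comm_ring, comm_monoid_mult}\<close> is that of commutative unital
  rings without the requirement \<open>0 \<noteq> 1\<close> made by \<^class>\<open>comm_ring_1\<close>.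
\<close>

locale poisson_algebra = lie_algebra scale bracket
  for scale :: "'k::field \<Rightarrow> 'a::{comm_ring, comm_monoid_mult} \<Rightarrow> 'a"
    and bracket :: "'a \<Rightarrow> 'a \<Rightarrow> 'a" +
  assumes scale_mult_left: "scale c x * y = scale c (x * y)"
    and leibniz: "bracket (x * y) z = x * bracket y z + y * bracket x z"

locale weakly_restricted_poisson_algebra =
  poisson_algebra scale bracket + restricted_lie_algebra scale bracket p pmap
  for scale :: "'k::field \<Rightarrow> 'a::{comm_ring, comm_monoid_mult} \<Rightarrow> 'a"
    and bracket :: "'a \<Rightarrow> 'a \<Rightarrow> 'a"
    and p :: nat and pmap :: "'a \<Rightarrow> 'a"

definition poisson_hom ::
    "('k::field \<Rightarrow> 'a \<Rightarrow> 'a) \<Rightarrow> ('a \<Rightarrow> 'a \<Rightarrow> 'a) \<Rightarrow> ('k \<Rightarrow> 'b \<Rightarrow> 'b) \<Rightarrow> ('b \<Rightarrow> 'b \<Rightarrow> 'b) \<Rightarrow>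
     ('a::{comm_ring, comm_monoid_mult} \<Rightarrow> 'b::{comm_ring, comm_monoid_mult}) \<Rightarrow> bool" where
  "poisson_hom scaleA bracketA scaleB bracketB \<phi> \<longleftrightarrow>
     Vector_Spaces.linear scaleA scaleB \<phi> \<and>
     \<phi> 1 = 1 \<and>
     (\<forall>x y. \<phi> (x * y) = \<phi> x * \<phi> y) \<and>
     (\<forall>x y. \<phi> (bracketA x y) = bracketB (\<phi> x) (\<phi> y))"


section \<open>The tensor algebra on two generators and its PBW filtration\<close>

text \<open>
  \<open>T(V)\<close> is the monoid algebra of the free monoid on two letters, the convolution algebra of
  finitely supported functions on words. Since \<^typ>\<open>('a, 'b) poly_mapping\<close> takes an additive
  index monoid, concatenation of words is written \<open>+\<close>.
\<close>

datatype gen = GX | GY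

datatype word = Word (letters: "gen list")

instantiation word :: monoid_add
begin
definition zero_word :: word where "zero_word = Word []"
definition plus_word :: "word \<Rightarrow> word \<Rightarrow> word" where "v + w = Word (letters v @ letters w)"
instance by standard (simp_all add: zero_word_def plus_word_def)
end

type_synonym 'k tensor = "(word, 'k) poly_mapping"

definition tscalar :: "'k::field \<Rightarrow> 'k tensor" where
  "tscalar c = Poly_Mapping.single 0 c"

definition tscale :: "'k::field \<Rightarrow> 'k tensor \<Rightarrow> 'k tensor" where
  "tscale c a = tscalar c * a"

definition tgen :: "gen \<Rightarrow> 'k::field tensor" where
  "tgen g = Poly_Mapping.single (Word [g]) 1"

definition comm :: "'r::ring \<Rightarrow> 'r \<Rightarrow> 'r" where
  "comm a b = a * b - b * a"

lemma tscalar_add: "tscalar (c + d) = tscalar c + tscalar d"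
  by (simp add: tscalar_def single_add)

lemma tscalar_mult: "tscalar (c * d) = tscalar c * tscalar d"
  by (simp add: tscalar_def mult_single)

lemma tscalar_1 [simp]: "tscalar 1 = 1"
  by (simp add: tscalar_def)

lemma tscalar_0 [simp]: "tscalar 0 = 0"
  by (simp add: tscalar_def)

interpretation tens: vector_space "tscale :: 'k::field \<Rightarrow> 'k tensor \<Rightarrow> 'k tensor"
  by unfold_locales (simp_all add: tscale_def tscalar_add tscalar_mult algebra_simps)

lemma tscalar_commute: "tscalar c * a = a * tscalar c"
proof (induction a rule: Poly_Mapping.update_induct)
  case const
  show ?case by simp
next
  case (update f w d)
  then have "Poly_Mapping.update w d f = f + Poly_Mapping.single w d"
    by (intro poly_mapping_eqI)
      (auto simp: lookup_update lookup_add lookup_single when_def in_keys_iff)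
  with update show ?case
    by (simp add: distrib_left distrib_right tscalar_def mult_single mult.commute)
qed

lemma tscale_mult_left: "tscale c a * b = tscale c (a * b)"
  by (simp add: tscale_def mult.assoc)

lemma tscale_mult_right: "a * tscale c b = tscale c (a * b)"
  by (metis tscale_def mult.assoc tscalar_commute)

text \<open>
  The free Lie algebra \<open>Lie(V)\<close> is realised in its enveloping algebra \<open>T(V)\<close>, as the Lie
  subalgebra generated by \<open>V\<close>.
\<close>

inductive_set free_lie :: "'k::field tensor set" where
  gen: "tgen g \<in> free_lie"
| add: "a \<in> free_lie \<Longrightarrow> b \<in> free_lie \<Longrightarrow> a + b \<in> free_lie"
| scale: "a \<in> free_lie \<Longrightarrow> tscale c a \<in> free_lie"
| comm: "a \<in> free_lie \<Longrightarrow> b \<in> free_lie \<Longrightarrow> comm a b \<in> free_lie"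

definition pbw :: "nat \<Rightarrow> 'k::field tensor set" where
  "pbw n = tens.span {prod_list as | as. length as \<le> n \<and> set as \<subseteq> free_lie}"

text \<open>\<open>F\<^sub>n\<^sub>-\<^sub>1\<close>, where \<open>F\<^sub>-\<^sub>1 = 0\<close>.\<close>

fun pbw_pred :: "nat \<Rightarrow> 'k::field tensor set" where
  "pbw_pred 0 = {0}"
| "pbw_pred (Suc n) = pbw n"

lemma subspace_pbw [simp]: "tens.subspace (pbw n)"
  by (simp add: pbw_def)

lemma subspace_pbw_pred [simp]: "tens.subspace (pbw_pred n)"
  by (cases n) (auto simp: tens.subspace_single_0)

lemmas pbw_closed =
  tens.subspace_0[OF subspace_pbw] tens.subspace_0[OF subspace_pbw_pred]
  tens.subspace_add[OF subspace_pbw] tens.subspace_add[OF subspace_pbw_pred]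
  tens.subspace_diff[OF subspace_pbw] tens.subspace_diff[OF subspace_pbw_pred]
  tens.subspace_neg[OF subspace_pbw] tens.subspace_neg[OF subspace_pbw_pred]
  tens.subspace_scale[OF subspace_pbw] tens.subspace_scale[OF subspace_pbw_pred]
  tens.subspace_sum[OF subspace_pbw] tens.subspace_sum[OF subspace_pbw_pred]

lemma pbw_mono: "m \<le> n \<Longrightarrow> pbw m \<subseteq> pbw n"
  unfolding pbw_def by (rule tens.span_mono) auto

lemma pbw_pred_subset: "pbw_pred n \<subseteq> pbw n"
  by (cases n) (auto simp: pbw_closed intro: pbw_mono[THEN subsetD, rotated])

lemma prod_list_in_pbw: "length as \<le> n \<Longrightarrow> set as \<subseteq> free_lie \<Longrightarrow> prod_list as \<in> pbw n"
  unfolding pbw_def by (rule tens.span_base) auto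

lemma one_in_pbw: "1 \<in> pbw n"
  using prod_list_in_pbw[of "[]" n] by simp

lemma free_lie_in_pbw: "a \<in> free_lie \<Longrightarrow> a \<in> pbw 1"
  using prod_list_in_pbw[of "[a]" 1] by simp

lemma pbw_induct [consumes 1, case_names prod add scale]:
  assumes "a \<in> pbw n"
    and prod: "\<And>as. length as \<le> n \<Longrightarrow> set as \<subseteq> free_lie \<Longrightarrow> P (prod_list as)"
    and add: "\<And>a b. P a \<Longrightarrow> P b \<Longrightarrow> P (a + b)"
    and scale: "\<And>c a. P a \<Longrightarrow> P (tscale c a)"
  shows "P a"
proof -
  have "P 0" using scale[OF prod[of "[]"], of 0] by (simp add: tscale_def)
  show ?thesis
    using assms(1) unfolding pbw_def
  proof (induction rule: tens.span_induct_alt)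
    case base
    show ?case by fact
  next
    case (step c x y)
    then show ?case using prod add scale by auto
  qed
qed

lemma pbw_mult:
  assumes "a \<in> pbw m" "b \<in> pbw n"
  shows "a * b \<in> pbw (m + n)"
  using assms(1)
proof (induction rule: pbw_induct)
  case (prod as)
  from assms(2) show ?case
  proof (induction rule: pbw_induct)
    case (prod bs)
    then show ?case
      using \<open>length as \<le> m\<close> \<open>set as \<subseteq> free_lie\<close> prod_list_in_pbw[of "as @ bs" "m + n"] by simp
  qed (simp_all add: distrib_left tscale_mult_right pbw_closed)
qed (simp_all add: distrib_right tscale_mult_left pbw_closed)

lemma pbw_pred_mult_left:
  assumes "a \<in> pbw_pred m" "b \<in> pbw n"
  shows "a * b \<in> pbw_pred (m + n)"
  using assms by (cases m) (auto simp: pbw_mult pbw_closed)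

lemma pbw_pred_mult_right:
  assumes "a \<in> pbw m" "b \<in> pbw_pred n"
  shows "a * b \<in> pbw_pred (m + n)"
  using assms by (cases n) (auto simp: pbw_mult pbw_closed)

lemma comm_add_left: "comm (a + b) c = comm a c + comm b c"
  and comm_add_right: "comm a (b + c) = comm a b + comm a c"
  and comm_mult_left: "comm (a * b) c = a * comm b c + comm a c * b"
  and comm_mult_right: "comm c (a * b) = a * comm c b + comm c a * b"
  and comm_diff_left: "comm (a - b) c = comm a c - comm b c"
  and comm_diff_right: "comm a (b - c) = comm a b - comm a c"
  by (simp_all add: comm_def algebra_simps)

lemma comm_tscale_left: "comm (tscale c a) b = tscale c (comm a b)"
  and comm_tscale_right: "comm a (tscale c b) = tscale c (comm a b)"
  by (simp_all add: comm_def tscale_mult_left tscale_mult_right tens.scale_right_diff_distrib)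

lemma comm_free_lie_prod:
  assumes "a \<in> free_lie" "length bs \<le> n" "set bs \<subseteq> free_lie"
  shows "comm a (prod_list bs) \<in> pbw n"
  using assms(2,3)
proof (induction bs arbitrary: n)
  case Nil
  then show ?case by (simp add: comm_def pbw_closed)
next
  case (Cons b bs)
  then obtain m where n: "n = Suc m" by (cases n) auto
  have "b * comm a (prod_list bs) \<in> pbw (1 + m)"
    using Cons n by (intro pbw_mult free_lie_in_pbw) auto
  moreover have "comm a b * prod_list bs \<in> pbw (1 + m)"
    using Cons n assms(1)
    by (intro pbw_mult free_lie_in_pbw free_lie.comm prod_list_in_pbw) auto
  ultimately show ?case by (simp add: comm_mult_right n pbw_closed)
qed

lemma comm_prod_prod:
  assumes "length as \<le> m" "set as \<subseteq> free_lie" "length bs \<le> n" "set bs \<subseteq> free_lie"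
  shows "comm (prod_list as) (prod_list bs) \<in> pbw_pred (m + n)"
  using assms(1,2)
proof (induction as arbitrary: m)
  case Nil
  then show ?case by (simp add: comm_def pbw_closed)
next
  case (Cons a as)
  then obtain k where m: "m = Suc k" by (cases m) auto
  have "a * comm (prod_list as) (prod_list bs) \<in> pbw_pred (1 + (k + n))"
    using Cons m by (intro pbw_pred_mult_right free_lie_in_pbw) auto
  moreover have "comm a (prod_list bs) * prod_list as \<in> pbw (n + k)"
    using Cons m assms(3,4)
    by (intro pbw_mult comm_free_lie_prod prod_list_in_pbw) auto
  ultimately show ?case by (simp add: comm_mult_left m pbw_closed add.commute)
qed

lemma pbw_comm:
  assumes "a \<in> pbw m" "b \<in> pbw n"
  shows "comm a b \<in> pbw_pred (m + n)"
  using assms(1)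
proof (induction rule: pbw_induct)
  case (prod as)
  from assms(2) show ?case
  proof (induction rule: pbw_induct)
    case (prod bs)
    then show ?case
      using \<open>length as \<le> m\<close> \<open>set as \<subseteq> free_lie\<close> by (intro comm_prod_prod)
  qed (simp_all add: comm_add_right comm_tscale_right pbw_closed)
qed (simp_all add: comm_add_left comm_tscale_left pbw_closed)

lemma pbw_pred_comm:
  assumes "a \<in> pbw_pred i" "b \<in> pbw j" "i + j = Suc n"
  shows "comm a b \<in> pbw_pred n" "comm b a \<in> pbw_pred n"
proof -
  show "comm a b \<in> pbw_pred n"
  proof (cases i)
    case 0
    then show ?thesis using assms by (simp add: comm_def pbw_closed)
  next
    case (Suc k)
    then show ?thesis using assms pbw_comm[of a k b j] by simp
  qed
  moreover have "comm b a = - comm a b" by (simp add: comm_def)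
  ultimately show "comm b a \<in> pbw_pred n" by (simp add: pbw_closed)
qed


section \<open>The associated graded algebra, i.e. the free Poisson algebra on two generators\<close>

text \<open>
  A finite family \<open>(f\<^sub>n)\<close> with \<open>f\<^sub>n \<in> F\<^sub>n\<close> is written as the polynomial \<open>\<Sum> f\<^sub>n t\<^sup>n\<close>
  over \<open>T(V)\<close>, with \<open>t\<close> central. The direct sum of the quotients \<open>F\<^sub>n / F\<^sub>n\<^sub>-\<^sub>1\<close> is
  obtained from these families by identifying \<open>f\<close> and \<open>g\<close> when \<open>f\<^sub>n - g\<^sub>n \<in> F\<^sub>n\<^sub>-\<^sub>1\<close>
  for all \<open>n\<close>. By the Poincare-Birkhoff-Witt theorem the result is \<open>Sym(Lie(V))\<close>.
\<close>

type_synonym 'k graded_tensor = "(nat, 'k tensor) poly_mapping"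

abbreviation component :: "'k::field graded_tensor \<Rightarrow> nat \<Rightarrow> 'k tensor" where
  "component \<equiv> Poly_Mapping.lookup"

definition gr_rel :: "'k::field graded_tensor \<Rightarrow> 'k graded_tensor \<Rightarrow> bool" where
  "gr_rel f g \<longleftrightarrow>
     (\<forall>n. component f n \<in> pbw n \<and> component g n \<in> pbw n \<and>
          component f n - component g n \<in> pbw_pred n)"

lemma part_equivp_gr_rel: "part_equivp gr_rel"
proof (rule part_equivpI)
  show "\<exists>f :: 'k::field graded_tensor. gr_rel f f"
    by (rule exI[of _ 0]) (simp add: gr_rel_def pbw_closed)
  show "symp (gr_rel :: 'k::field graded_tensor \<Rightarrow> _)"
  proof (rule sympI)
    fix f g :: "'k::field graded_tensor"
    assume fg: "gr_rel f g"
    have "component g n - component f n \<in> pbw_pred n" for n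
      using fg pbw_closed(8)[of "component f n - component g n" n] by (simp add: gr_rel_def)
    with fg show "gr_rel g f" by (simp add: gr_rel_def)
  qed
  show "transp (gr_rel :: 'k::field graded_tensor \<Rightarrow> _)"
  proof (rule transpI)
    fix f g h :: "'k::field graded_tensor"
    assume fg: "gr_rel f g" and gh: "gr_rel g h"
    have "component f n - component h n \<in> pbw_pred n" for n
      using fg gh pbw_closed(4)[of "component f n - component g n" n "component g n - component h n"]
      by (simp add: gr_rel_def)
    with fg gh show "gr_rel f h" by (simp add: gr_rel_def)
  qed
qed

quotient_type (overloaded) 'k free_poisson = "'k::field graded_tensor" / partial: gr_rel
  by (rule part_equivp_gr_rel)

lemma gr_relI:
  assumes "\<And>n. component f n \<in> pbw n" "\<And>n. component g n \<in> pbw n"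
    "\<And>n. component (f - g) n \<in> pbw_pred n"
  shows "gr_rel f g"
  using assms by (simp add: gr_rel_def lookup_minus)

lemma gr_relD:
  assumes "gr_rel f g"
  shows "component f n \<in> pbw n" "component g n \<in> pbw n" "component (f - g) n \<in> pbw_pred n"
  using assms by (simp_all add: gr_rel_def lookup_minus)

lemma component_mult:
  fixes f g :: "'k::field graded_tensor"
  shows "component (f * g) n = (\<Sum>i\<le>n. component f i * component g (n - i))"
proof -
  have "component (f * g) n = (\<Sum>i. component f i * (\<Sum>j. component g j when n = i + j))"
    by (simp add: lookup_mult)
  also have "(\<lambda>i. component f i * (\<Sum>j. component g j when n = i + j)) =
             (\<lambda>i. (component f i * component g (n - i)) when i \<le> n)"
  proof
    fix i
    have "(\<Sum>j. component g j when n = i + j) = (component g (n - i) when i \<le> n)"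
    proof (cases "i \<le> n")
      case True
      then have "(\<lambda>j. component g j when n = i + j) = (\<lambda>j. component g j when n - i = j)"
        using True by (auto simp: when_def fun_eq_iff)
      then have "(\<Sum>j. component g j when n = i + j) = (\<Sum>j. component g j when n - i = j)"
        by (rule arg_cong)
      then show ?thesis using True by (simp add: when_def)
    next
      case False
      then have "(\<lambda>j. component g j when n = i + j) = (\<lambda>j. 0)"
        by (auto simp: when_def)
      then show ?thesis using False by simp
    qed
    then show "component f i * (\<Sum>j. component g j when n = i + j) =
               ((component f i * component g (n - i)) when i \<le> n)"
      by (simp add: when_def)
  qed
  also have "(\<Sum>i. (component f i * component g (n - i)) when i \<le> n) =
             (\<Sum>i\<le>n. component f i * component g (n - i))"
    by (subst Sum_any.expand_superset[of "{..n}"]) (auto simp: when_def)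
  finally show ?thesis .
qed

lemma component_comm:
  fixes f g :: "'k::field graded_tensor"
  shows "component (comm f g) n = (\<Sum>i\<le>n. comm (component f i) (component g (n - i)))"
proof -
  have "component (g * f) n = (\<Sum>i\<le>n. component g (n - i) * component f i)"
    unfolding component_mult
    by (rule sum.reindex_bij_witness[of _ "\<lambda>i. n - i" "\<lambda>i. n - i"]) auto
  then show ?thesis
    by (simp add: comm_def lookup_minus component_mult sum_subtractf)
qed

lemma component_mult_pbw:
  assumes "\<And>n. component f n \<in> pbw n" "\<And>n. component g n \<in> pbw n"
  shows "component (f * g) n \<in> pbw n"
  unfolding component_mult
  proof (intro tens.subspace_sum subspace_pbw)
  fix i assume "i \<in> {..n}"
  then show "(*) (component f i) (component g (n - i)) \<in> pbw n"
    using pbw_mult[OF assms, of i "n - i"] by simp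
qed

lemma component_mult_pbw_pred_left:
  assumes "\<And>n. component f n \<in> pbw_pred n" "\<And>n. component g n \<in> pbw n"
  shows "component (f * g) n \<in> pbw_pred n"
  unfolding component_mult
  proof (intro tens.subspace_sum subspace_pbw_pred)
  fix i assume "i \<in> {..n}"
  then show "(*) (component f i) (component g (n - i)) \<in> pbw_pred n"
    using pbw_pred_mult_left[OF assms, of i "n - i"] by simp
qed

lemma component_mult_pbw_pred_right:
  assumes "\<And>n. component f n \<in> pbw n" "\<And>n. component g n \<in> pbw_pred n"
  shows "component (f * g) n \<in> pbw_pred n"
  unfolding component_mult
  proof (intro tens.subspace_sum subspace_pbw_pred)
  fix i assume "i \<in> {..n}"
  then show "(*) (component f i) (component g (n - i)) \<in> pbw_pred n"
    using pbw_pred_mult_right[OF assms, of i "n - i"] by simp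
qed

lemma component_comm_pbw:
  assumes "\<And>n. component f n \<in> pbw n" "\<And>n. component g n \<in> pbw n"
  shows "component (comm f g) n \<in> pbw_pred n"
  unfolding component_comm
  proof (intro tens.subspace_sum subspace_pbw_pred)
  fix i assume "i \<in> {..n}"
  then show "comm (component f i) (component g (n - i)) \<in> pbw_pred n"
    using pbw_comm[OF assms, of i "n - i"] by simp
qed

lemma component_comm_pbw_pred:
  assumes "\<And>n. component f n \<in> pbw_pred n" "\<And>n. component g n \<in> pbw n"
  shows "component (comm f g) (Suc n) \<in> pbw_pred n" "component (comm g f) (Suc n) \<in> pbw_pred n"
  unfolding component_comm
  proof (intro tens.subspace_sum subspace_pbw_pred)
  fix i assume "i \<in> {..Suc n}"
  then show "comm (component f i) (component g (Suc n - i)) \<in> pbw_pred n"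
    using pbw_pred_comm(1)[OF assms, of i "Suc n - i" n] by simp
next
  show "(\<Sum>i\<le>Suc n. comm (component g i) (component f (Suc n - i))) \<in> pbw_pred n"
  proof (intro tens.subspace_sum subspace_pbw_pred)
    fix i assume "i \<in> {..Suc n}"
    then show "comm (component g i) (component f (Suc n - i)) \<in> pbw_pred n"
      using pbw_pred_comm(2)[OF assms, of "Suc n - i" i n] by simp
  qed
qed

text \<open>
  The commutator of \<open>a t\<^sup>m\<close> and \<open>b t\<^sup>n\<close> is \<open>(a b - b a) t\<^sup>m\<^sup>+\<^sup>n\<close> and \<open>a b - b a\<close> lies in
  \<open>F\<^sub>m\<^sub>+\<^sub>n\<^sub>-\<^sub>1\<close>; division by \<open>t\<close> therefore gives the Poisson bracket
  \<open>F\<^sub>m / F\<^sub>m\<^sub>-\<^sub>1 \<times> F\<^sub>n / F\<^sub>n\<^sub>-\<^sub>1 \<rightarrow> F\<^sub>m\<^sub>+\<^sub>n\<^sub>-\<^sub>1 / F\<^sub>m\<^sub>+\<^sub>n\<^sub>-\<^sub>2\<close>.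
\<close>

definition div_t :: "'k::field graded_tensor \<Rightarrow> 'k graded_tensor" where
  "div_t f = Poly_Mapping.map_key Suc f"

definition gr_comm :: "'k::field graded_tensor \<Rightarrow> 'k graded_tensor \<Rightarrow> 'k graded_tensor" where
  "gr_comm f g = div_t (comm f g)"

lemma component_div_t [simp]: "component (div_t f) n = component f (Suc n)"
  by (simp add: div_t_def map_key.rep_eq)

lemma div_t_diff: "div_t (f - g) = div_t f - div_t g"
  by (rule poly_mapping_eqI) (simp add: lookup_minus)

lemma gr_rel_mult:
  assumes "gr_rel f f'" "gr_rel g g'"
  shows "gr_rel (f * g) (f' * g')"
proof (rule gr_relI)
  fix n
  note f = gr_relD[OF assms(1)] and g = gr_relD[OF assms(2)]
  show "component (f * g) n \<in> pbw n" "component (f' * g') n \<in> pbw n"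
    by (intro component_mult_pbw f g)+
  have "f * g - f' * g' = (f - f') * g + f' * (g - g')" by (simp add: algebra_simps)
  then show "component (f * g - f' * g') n \<in> pbw_pred n"
    by (simp only: lookup_add)
      (intro pbw_closed component_mult_pbw_pred_left component_mult_pbw_pred_right f g)
qed

lemma gr_rel_comm:
  assumes "gr_rel f f'" "gr_rel g g'"
  shows "gr_rel (gr_comm f g) (gr_comm f' g')"
proof (rule gr_relI)
  fix n
  note f = gr_relD[OF assms(1)] and g = gr_relD[OF assms(2)]
  show "component (gr_comm f g) n \<in> pbw n" "component (gr_comm f' g') n \<in> pbw n"
    using component_comm_pbw[OF f(1) g(1), of "Suc n"] component_comm_pbw[OF f(2) g(2), of "Suc n"]
    by (simp_all add: gr_comm_def)
  have "comm f g - comm f' g' = comm (f - f') g + comm f' (g - g')"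
    by (simp add: comm_def algebra_simps)
  then have "component (gr_comm f g - gr_comm f' g') n =
      component (comm (f - f') g) (Suc n) + component (comm f' (g - g')) (Suc n)"
    by (metis div_t_diff component_div_t gr_comm_def lookup_add)
  then show "component (gr_comm f g - gr_comm f' g') n \<in> pbw_pred n"
    by (simp only:) (intro pbw_closed component_comm_pbw_pred f g)
qed

instantiation free_poisson :: (field) comm_ring_1
begin

lift_definition zero_free_poisson :: "'a free_poisson" is 0
  by (simp add: gr_rel_def pbw_closed)

lift_definition one_free_poisson :: "'a free_poisson" is 1
  by (auto simp: gr_rel_def lookup_one when_def one_in_pbw pbw_closed)

lift_definition plus_free_poisson :: "'a free_poisson \<Rightarrow> 'a free_poisson \<Rightarrow> 'a free_poisson" is "(+)"
proof (rule gr_relI)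
  fix f f' g g' :: "'a graded_tensor" and n
  assume f: "gr_rel f f'" and g: "gr_rel g g'"
  have "f + g - (f' + g') = (f - f') + (g - g')" by simp
  then show "component (f + g - (f' + g')) n \<in> pbw_pred n"
    by (simp only: lookup_add) (intro pbw_closed gr_relD[OF f] gr_relD[OF g])
qed (simp_all add: lookup_add pbw_closed gr_relD)

lift_definition uminus_free_poisson :: "'a free_poisson \<Rightarrow> 'a free_poisson" is uminus
proof (rule gr_relI)
  fix f f' :: "'a graded_tensor" and n
  assume f: "gr_rel f f'"
  have "- f - (- f') = - (f - f')" by simp
  then show "component (- f - (- f')) n \<in> pbw_pred n"
    by (simp only: lookup_uminus) (intro pbw_closed gr_relD[OF f])
qed (simp_all add: pbw_closed gr_relD)

definition minus_free_poisson :: "'a free_poisson \<Rightarrow> 'a free_poisson \<Rightarrow> 'a free_poisson" where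
  "minus_free_poisson a b = a + (- b)"

lift_definition times_free_poisson :: "'a free_poisson \<Rightarrow> 'a free_poisson \<Rightarrow> 'a free_poisson" is "(*)"
  by (rule gr_rel_mult)

instance
proof
  fix a b c :: "'a free_poisson"
  show "a + b + c = a + (b + c)"
    by transfer (simp add: gr_rel_def add.assoc lookup_add pbw_closed)
  show "a + b = b + a"
    by transfer (simp add: gr_rel_def add.commute lookup_add pbw_closed)
  show "0 + a = a"
    by transfer simp
  show "- a + a = 0"
    by transfer (simp add: gr_rel_def pbw_closed)
  show "a - b = a + - b"
    by (simp add: minus_free_poisson_def)
  show "a * b * c = a * (b * c)"
    by transfer (simp add: mult.assoc gr_rel_mult)
  show "1 * a = a"
    by transfer simp
  show "(a + b) * c = a * c + b * c"
  proof transfer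
    fix f g h :: "'a graded_tensor"
    assume "gr_rel f f" "gr_rel g g" "gr_rel h h"
    then have "gr_rel (f * h) (f * h)" "gr_rel (g * h) (g * h)" by (auto intro: gr_rel_mult)
    then show "gr_rel ((f + g) * h) (f * h + g * h)"
      by (simp add: distrib_right gr_rel_def lookup_add pbw_closed)
  qed
  show "a * b = b * a"
  proof transfer
    fix f g :: "'a graded_tensor"
    assume f: "gr_rel f f" and g: "gr_rel g g"
    show "gr_rel (f * g) (g * f)"
    proof (rule gr_relI)
      fix n
      show "component (f * g - g * f) n \<in> pbw_pred n"
        using component_comm_pbw[OF gr_relD(1)[OF f] gr_relD(1)[OF g]] by (simp add: comm_def)
    qed (intro component_mult_pbw gr_relD[OF f] gr_relD[OF g])+
  qed
  show "(0 :: 'a free_poisson) \<noteq> 1"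
  proof transfer
    show "\<not> gr_rel (0 :: 'a graded_tensor) 1"
    proof
      assume "gr_rel (0 :: 'a graded_tensor) 1"
      from gr_relD(3)[OF this, of 0] show False by (simp add: lookup_one)
    qed
  qed
qed

end

lemma gr_rel_scalar:
  "gr_rel (Poly_Mapping.single 0 (tscalar c)) (Poly_Mapping.single 0 (tscalar c))"
proof -
  have "tscalar c \<in> pbw 0"
    using tens.subspace_scale[OF subspace_pbw one_in_pbw, of c 0] by (simp add: tscale_def)
  then show ?thesis
    by (simp add: gr_rel_def lookup_single when_def pbw_closed)
qed

lift_definition fp_scalar :: "'k::field \<Rightarrow> 'k free_poisson" is
  "\<lambda>c. Poly_Mapping.single 0 (tscalar c)"
  by (rule gr_rel_scalar)

definition fp_scale :: "'k::field \<Rightarrow> 'k free_poisson \<Rightarrow> 'k free_poisson" where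
  "fp_scale c a = fp_scalar c * a"

lift_definition fp_bracket :: "'k::field free_poisson \<Rightarrow> 'k free_poisson \<Rightarrow> 'k free_poisson" is
  gr_comm
  by (rule gr_rel_comm)

text \<open>The class of \<open>a \<in> F\<^sub>n\<close> in the summand \<open>F\<^sub>n / F\<^sub>n\<^sub>-\<^sub>1\<close>.\<close>

definition symbol :: "nat \<Rightarrow> 'k::field tensor \<Rightarrow> 'k free_poisson" where
  "symbol n a = abs_free_poisson (Poly_Mapping.single n a)"

definition fp_gen :: "gen \<Rightarrow> 'k::field free_poisson" where
  "fp_gen g = symbol 1 (tgen g)"

lemma gr_rel_refl_eq: "gr_rel f f \<Longrightarrow> f = g \<Longrightarrow> gr_rel f g"
  by simp

lemma gr_rel_add:
  assumes "gr_rel f f" "gr_rel g g"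
  shows "gr_rel (f + g) (f + g)"
  using assms by (simp add: gr_rel_def lookup_add pbw_closed)

lemma component_comm_0:
  assumes "gr_rel f f" "gr_rel g g"
  shows "component (comm f g) 0 = 0"
  using component_comm_pbw[OF gr_relD(1)[OF assms(1)] gr_relD(1)[OF assms(2)], of 0] by simp

lemma div_t_add: "div_t (f + g) = div_t f + div_t g"
  by (rule poly_mapping_eqI) (simp add: lookup_add)

lemma div_t_mult_left: "component C 0 = 0 \<Longrightarrow> div_t (C * f) = div_t C * f"
  by (rule poly_mapping_eqI) (simp add: component_mult sum.atMost_Suc_shift del: sum.atMost_Suc)

lemma div_t_mult_right:
  assumes "component C 0 = 0"
  shows "div_t (f * C) = f * div_t C"
proof (rule poly_mapping_eqI)
  fix n
  have "component (div_t (f * C)) n = (\<Sum>i\<le>n. component f i * component C (Suc n - i))"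
    using assms by (simp add: component_mult)
  also have "\<dots> = component (f * div_t C) n"
    by (simp add: component_mult Suc_diff_le cong: sum.cong_simp)
  finally show "component (div_t (f * C)) n = component (f * div_t C) n" .
qed

lemma comm_div_t: "component C 0 = 0 \<Longrightarrow> comm f (div_t C) = div_t (comm f C)"
  by (simp add: comm_def div_t_mult_left div_t_mult_right div_t_diff)

lemma comm_scalar: "comm (Poly_Mapping.single 0 (tscalar c)) g = (0 :: 'k::field graded_tensor)"
proof (rule poly_mapping_eqI)
  fix n
  have "comm (tscalar c) a = 0" for a :: "'k tensor"
    by (simp add: comm_def tscalar_commute)
  then show "component (comm (Poly_Mapping.single 0 (tscalar c)) g) n = component 0 n"
    by (auto simp: component_comm lookup_single when_def comm_def[of 0] intro!: sum.neutral)
qed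

lemma fp_bracket_mult_left: "fp_bracket (a * b) c = a * fp_bracket b c + fp_bracket a c * b"
proof transfer
  fix f g h :: "'a graded_tensor"
  assume *: "gr_rel f f" "gr_rel g g" "gr_rel h h"
  have "gr_rel (gr_comm (f * g) h) (gr_comm (f * g) h)"
    using * by (intro gr_rel_comm gr_rel_mult)
  moreover have "gr_comm (f * g) h = f * gr_comm g h + gr_comm f h * g"
    using * by (simp add: gr_comm_def comm_mult_left div_t_add
      div_t_mult_left div_t_mult_right component_comm_0)
  ultimately show "gr_rel (gr_comm (f * g) h) (f * gr_comm g h + gr_comm f h * g)"
    by (rule gr_rel_refl_eq)
qed

lemma fp_bracket_scalar: "fp_bracket (fp_scalar c) a = 0"
  by transfer (simp add: gr_comm_def comm_scalar, simp add: gr_rel_def div_t_def pbw_closed)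

lemma fp_bracket_self: "fp_bracket a a = 0"
  by transfer (simp add: gr_comm_def comm_def, simp add: gr_rel_def div_t_def pbw_closed)

lemma fp_bracket_add_left: "fp_bracket (a + b) c = fp_bracket a c + fp_bracket b c"
proof transfer
  fix f g h :: "'a graded_tensor"
  assume *: "gr_rel f f" "gr_rel g g" "gr_rel h h"
  have "gr_rel (gr_comm (f + g) h) (gr_comm (f + g) h)"
    using * by (intro gr_rel_comm gr_rel_add)
  moreover have "gr_comm (f + g) h = gr_comm f h + gr_comm g h"
    using * by (simp add: gr_comm_def comm_add_left div_t_add)
  ultimately show "gr_rel (gr_comm (f + g) h) (gr_comm f h + gr_comm g h)"
    by (rule gr_rel_refl_eq)
qed

lemma fp_bracket_add_right: "fp_bracket c (a + b) = fp_bracket c a + fp_bracket c b"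
proof transfer
  fix f g h :: "'a graded_tensor"
  assume *: "gr_rel f f" "gr_rel g g" "gr_rel h h"
  have "gr_rel (gr_comm h (f + g)) (gr_comm h (f + g))"
    using * by (intro gr_rel_comm gr_rel_add)
  moreover have "gr_comm h (f + g) = gr_comm h f + gr_comm h g"
    using * by (simp add: gr_comm_def comm_add_right div_t_add)
  ultimately show "gr_rel (gr_comm h (f + g)) (gr_comm h f + gr_comm h g)"
    by (rule gr_rel_refl_eq)
qed

lemma fp_bracket_skew: "fp_bracket a b = - fp_bracket b a"
proof -
  have "fp_bracket (a + b) (a + b) = fp_bracket a b + fp_bracket b a"
    unfolding fp_bracket_add_left fp_bracket_add_right by (simp add: fp_bracket_self)
  then show ?thesis
    by (metis fp_bracket_self eq_neg_iff_add_eq_0)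
qed

lemma fp_bracket_jacobi:
  "fp_bracket a (fp_bracket b c) + fp_bracket b (fp_bracket c a) + fp_bracket c (fp_bracket a b) = 0"
proof transfer
  fix f g h :: "'a graded_tensor"
  assume *: "gr_rel f f" "gr_rel g g" "gr_rel h h"
  have "gr_comm f (gr_comm g h) + gr_comm g (gr_comm h f) + gr_comm h (gr_comm f g) =
        div_t (div_t (comm f (comm g h) + comm g (comm h f) + comm h (comm f g)))"
    using * by (simp add: gr_comm_def comm_div_t component_comm_0 div_t_add)
  also have "comm f (comm g h) + comm g (comm h f) + comm h (comm f g) = 0"
    by (simp add: comm_def algebra_simps)
  finally show "gr_rel (gr_comm f (gr_comm g h) + gr_comm g (gr_comm h f) + gr_comm h (gr_comm f g)) 0"
    by (simp add: gr_rel_def div_t_def pbw_closed)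
qed

lemma fp_scalar_add: "fp_scalar (c + d) = fp_scalar c + fp_scalar d"
proof transfer
  fix c d :: 'a
  show "gr_rel (Poly_Mapping.single 0 (tscalar (c + d)))
      (Poly_Mapping.single 0 (tscalar c) + Poly_Mapping.single 0 (tscalar d))"
    using gr_rel_scalar[of "c + d"] by (rule gr_rel_refl_eq) (simp add: tscalar_add single_add)
qed

lemma fp_scalar_mult: "fp_scalar (c * d) = fp_scalar c * fp_scalar d"
proof transfer
  fix c d :: 'a
  show "gr_rel (Poly_Mapping.single 0 (tscalar (c * d)))
      (Poly_Mapping.single 0 (tscalar c) * Poly_Mapping.single 0 (tscalar d))"
    using gr_rel_scalar[of "c * d"] by (rule gr_rel_refl_eq) (simp add: tscalar_mult mult_single)
qed

lemma fp_scalar_1: "fp_scalar 1 = 1"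
proof transfer
  show "gr_rel (Poly_Mapping.single 0 (tscalar 1)) (1 :: 'a graded_tensor)"
    using gr_rel_scalar[of 1] by (rule gr_rel_refl_eq) simp
qed

theorem poisson_algebra_free_poisson:
  "poisson_algebra (fp_scale :: 'k::field \<Rightarrow> _) fp_bracket"
proof unfold_locales
  fix a b c :: "'k free_poisson" and r s :: 'k
  show "fp_scale r (a + b) = fp_scale r a + fp_scale r b"
    by (simp add: fp_scale_def distrib_left)
  show "fp_scale (r + s) a = fp_scale r a + fp_scale s a"
    by (simp add: fp_scale_def fp_scalar_add distrib_right)
  show "fp_scale r (fp_scale s a) = fp_scale (r * s) a"
    by (simp add: fp_scale_def fp_scalar_mult mult.assoc)
  show "fp_scale 1 a = a"
    by (simp add: fp_scale_def fp_scalar_1)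
  show "fp_scale r a * b = fp_scale r (a * b)"
    by (simp add: fp_scale_def mult.assoc)
  show scale_left: "fp_bracket (fp_scale r a) b = fp_scale r (fp_bracket a b)" for a b
    by (simp add: fp_scale_def fp_bracket_mult_left fp_bracket_scalar)
  show "fp_bracket a (fp_scale r b) = fp_scale r (fp_bracket a b)"
    using scale_left[of b a] fp_bracket_skew[of a b] fp_bracket_skew[of a "fp_scale r b"]
    by (simp add: fp_scale_def)
  show "fp_bracket (a * b) c = a * fp_bracket b c + b * fp_bracket a c"
    by (simp add: fp_bracket_mult_left mult.commute)
qed (rule fp_bracket_add_left fp_bracket_add_right fp_bracket_self fp_bracket_jacobi)+


section \<open>The canonical quantized polynomial\<close>

text \<open>
  Here \<^term>\<open>p\<close> is the characteristic of the field, and \<open>(x y)\<^sup>p - x\<^sup>p y\<^sup>p\<close> then lies in \<open>F\<^sub>p\<^sub>+\<^sub>1\<close>.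
\<close>

definition quantized_P :: "nat \<Rightarrow> 'k::field free_poisson" where
  "quantized_P p = symbol (p + 1) ((tgen GX * tgen GY) ^ p - tgen GX ^ p * tgen GY ^ p)"

text \<open>
  Existence and uniqueness of the morphism are the universal property of the free Poisson algebra.
\<close>

definition free_poisson_eval ::
    "('k::field \<Rightarrow> 'a \<Rightarrow> 'a) \<Rightarrow> ('a \<Rightarrow> 'a \<Rightarrow> 'a) \<Rightarrow> 'a \<Rightarrow> 'a \<Rightarrow>
     'k free_poisson \<Rightarrow> 'a::{comm_ring, comm_monoid_mult}" where
  "free_poisson_eval scale bracket x y =
     (THE \<phi>. poisson_hom fp_scale fp_bracket scale bracket \<phi> \<and>
             \<phi> (fp_gen GX) = x \<and> \<phi> (fp_gen GY) = y)"

definition quantized_P_at ::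
    "nat \<Rightarrow> ('k::field \<Rightarrow> 'a \<Rightarrow> 'a) \<Rightarrow> ('a \<Rightarrow> 'a \<Rightarrow> 'a) \<Rightarrow> 'a \<Rightarrow> 'a \<Rightarrow>
     'a::{comm_ring, comm_monoid_mult}" where
  "quantized_P_at p scale bracket x y = free_poisson_eval scale bracket x y (quantized_P p)"

end

theory Submission
  imports Defs
begin

text \<open>
  Write \<open>\<Lambda>(x, y)\<close> for the Jacobson polynomial that measures the failure of the \<open>p\<close>-map to be
  additive. Everything follows from one identity in the free Poisson algebra,
  \<open>2 P(x, y) = 2 (x\<^sup>p + y\<^sup>p) \<Lambda>(x, y) - \<Lambda>(x\<^sup>2, y\<^sup>2) - \<Lambda>(x\<^sup>2 + y\<^sup>2, 2 x y)\<close>,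
  which is \<open>two_quantized_P\<close>. Given (i) at \<open>x\<close>, \<open>y\<close> and \<open>x + y\<close>, expanding both sides of
  \<open>((x + y)\<^sup>2)\<^bsup>{p}\<^esup> = 2 (x + y)\<^sup>p (x + y)\<^bsup>{p}\<^esup>\<close> with the sum rule of the \<open>p\<close>-map gives
  twice the product rule (ii), with exactly the right-hand side of the identity in the place of
  \<open>2 P(x, y)\<close>. Conversely \<open>\<Lambda>\<close> vanishes on commuting arguments, so that the identity yields
  \<open>P(x, x) = 0\<close> and (ii) at \<open>y = x\<close> is (i).

  The identity is the leading term of an equation in \<open>T(V)\<close>. In an associative algebra of
  characteristic \<open>p\<close> the formula \<open>(a + b)\<^sup>p = a\<^sup>p + b\<^sup>p + \<Lambda>(a, b)\<close> holds with respect to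
  the commutator (\<open>jacobson_formula\<close>). Applying it to both sides of \<open>((X + Y)\<^sup>2)\<^sup>p = ((X + Y)\<^sup>p)\<^sup>2\<close>
  expresses \<open>2 (X Y)\<^sup>p - 2 X\<^sup>p Y\<^sup>p\<close> by values of \<open>\<Lambda>\<close> up to terms in \<open>F\<^sub>p\<close>, and
  \<open>\<Lambda>\<close> is compatible with passing to the associated graded algebra
  (\<open>symbol_jacobson_Lambda\<close>).

  To move the identity to a Poisson algebra \<open>A\<close>, the morphism from the associated graded algebra of
  \<open>T(V)\<close> to \<open>A\<close> must be shown to exist (\<open>free_poisson_eval\<close>). This needs the
  Poincare-Birkhoff-Witt theorem for the Lie algebra \<open>A\<close>, in the following form: for each \<open>n\<close> there
  is a linear map on the enveloping algebra of \<open>A\<close> with values in \<open>A\<close> that kills products of fewer than \<open>n\<close>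
  elements and multiplies \<open>n\<close> elements in the commutative algebra \<open>A\<close>
  (\<open>enveloping_functional_exists\<close>). Composed with \<open>T(V) \<rightarrow> U(A)\<close>, these maps are the
  components of the required morphism.
\<close>


section \<open>Linear maps on the enveloping algebra of a Lie algebra\<close>

context lie_algebra
begin

lemma bracket_skew: "bracket a b = - bracket b a"
proof -
  have "bracket (a + b) (a + b) = bracket a b + bracket b a"
    unfolding bracket_add_left bracket_add_right by (simp add: bracket_self)
  then show ?thesis by (simp add: bracket_self eq_neg_iff_add_eq_0)
qed

lemma bracket_zero_left: "bracket 0 a = 0"
  using bracket_scale_left[of 0 0 a] by simp

lemma bracket_zero_right: "bracket a 0 = 0"
  using bracket_scale_right[of a 0 0] by simp

lemma bracket_minus_right: "bracket a (- b) = - bracket a b"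
  using bracket_add_right[of a b "- b"] by (simp add: bracket_zero_right eq_neg_iff_add_eq_0 add.commute)

definition multilinear :: "('a list \<Rightarrow> 'a) \<Rightarrow> bool" where
  "multilinear f \<longleftrightarrow>
     (\<forall>us vs a b. f (us @ (a + b) # vs) = f (us @ a # vs) + f (us @ b # vs)) \<and>
     (\<forall>us vs c a. f (us @ scale c a # vs) = scale c (f (us @ a # vs)))"

lemma multilinear_add: "multilinear f \<Longrightarrow> f (us @ (a + b) # vs) = f (us @ a # vs) + f (us @ b # vs)"
  and multilinear_scale: "multilinear f \<Longrightarrow> f (us @ scale c a # vs) = scale c (f (us @ a # vs))"
  by (auto simp: multilinear_def)

lemma multilinear_zero: "multilinear f \<Longrightarrow> f (us @ 0 # vs) = 0"
  using multilinear_scale[of f us 0 0 vs] by simp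

lemma multilinear_minus: "multilinear f \<Longrightarrow> f (us @ (- a) # vs) = - f (us @ a # vs)"
  using multilinear_scale[of f us "-1" a vs] by simp

lemma multilinear_eqI:
  assumes f: "multilinear f" and g: "multilinear g" and B: "span B = UNIV"
    and eq: "\<And>bs. set bs \<subseteq> B \<Longrightarrow> length bs = length as \<Longrightarrow> f bs = g bs"
  shows "f as = g as"
proof -
  have "f (us @ vs) = g (us @ vs)" if "set us \<subseteq> B" "length (us @ vs) = length as" for us vs
    using that
  proof (induction vs arbitrary: us)
    case Nil
    then show ?case by (simp add: eq)
  next
    case (Cons a vs)
    have "a \<in> span B" by (simp add: B)
    then show ?case
    proof (induction rule: span_induct_alt)
      case base
      then show ?case by (simp add: multilinear_zero f g)
    next
      case (step c x y)
      then show ?case using Cons.IH[of "us @ [x]"] Cons.prems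
        by (simp add: multilinear_add multilinear_scale f g)
    qed
  qed
  from this[of "[]" as] show ?thesis by simp
qed

definition basis :: "'a set" where "basis = extend_basis {}"

lemma independent_basis: "independent basis" and span_basis: "span basis = UNIV"
  by (simp_all add: basis_def independent_extend_basis independent_empty)

definition linear_ext :: "('a \<Rightarrow> 'a) \<Rightarrow> 'a \<Rightarrow> 'a" where
  "linear_ext g a = (\<Sum>b | representation basis a b \<noteq> 0. scale (representation basis a b) (g b))"

lemma linear_ext_superset:
  assumes "finite S" "{b. representation basis a b \<noteq> 0} \<subseteq> S"
  shows "linear_ext g a = (\<Sum>b\<in>S. scale (representation basis a b) (g b))"
  unfolding linear_ext_def by (rule sum.mono_neutral_left) (use assms in auto)

lemma linear_ext_add: "linear_ext g (a + b) = linear_ext g a + linear_ext g b"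
proof -
  let ?S = "{x. representation basis a x \<noteq> 0} \<union> {x. representation basis b x \<noteq> 0}"
  have r: "representation basis (a + b) x = representation basis a x + representation basis b x" for x
    by (simp add: representation_add independent_basis span_basis)
  have fin: "finite ?S" by (simp add: finite_representation)
  have "linear_ext g (a + b) = (\<Sum>x\<in>?S. scale (representation basis (a + b) x) (g x))"
    by (rule linear_ext_superset[OF fin]) (auto simp: r)
  also have "\<dots> = linear_ext g a + linear_ext g b"
    by (simp add: r scale_left_distrib sum.distrib linear_ext_superset[OF fin])
  finally show ?thesis .
qed

lemma linear_ext_scale: "linear_ext g (scale c a) = scale c (linear_ext g a)"
proof -
  have r: "representation basis (scale c a) x = c * representation basis a x" for x
    by (simp add: representation_scale independent_basis span_basis)
  have "linear_ext g (scale c a) =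
      (\<Sum>x | representation basis a x \<noteq> 0. scale (representation basis (scale c a) x) (g x))"
    by (rule linear_ext_superset[OF finite_representation]) (auto simp: r)
  then show ?thesis
    by (simp add: r linear_ext_def scale_sum_right)
qed

lemma linear_ext_basis: "b \<in> basis \<Longrightarrow> linear_ext g b = g b"
  using linear_ext_superset[of "{b}" b g]
  by (auto simp: representation_basis[OF independent_basis])

lemma linear_ext_fun_add: "linear_ext (\<lambda>b. g b + h b) a = linear_ext g a + linear_ext h a"
  by (simp add: linear_ext_def scale_right_distrib sum.distrib)

lemma linear_ext_fun_scale: "linear_ext (\<lambda>b. scale c (g b)) a = scale c (linear_ext g a)"
  by (simp add: linear_ext_def scale_sum_right mult.commute)

fun multilinear_ext :: "('a list \<Rightarrow> 'a) \<Rightarrow> 'a list \<Rightarrow> 'a" where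
  "multilinear_ext f [] = f []"
| "multilinear_ext f (a # as) = linear_ext (\<lambda>b. multilinear_ext (\<lambda>bs. f (b # bs)) as) a"

lemma multilinear_multilinear_ext: "multilinear (multilinear_ext f)"
proof -
  have "multilinear_ext f (us @ (a + b) # vs) =
      multilinear_ext f (us @ a # vs) + multilinear_ext f (us @ b # vs)" for us a b vs f
    by (induction us arbitrary: f) (simp_all add: linear_ext_add linear_ext_fun_add)
  moreover have "multilinear_ext f (us @ scale c a # vs) =
      scale c (multilinear_ext f (us @ a # vs))" for us a c vs f
    by (induction us arbitrary: f) (simp_all add: linear_ext_scale linear_ext_fun_scale)
  ultimately show ?thesis by (simp add: multilinear_def)
qed

lemma multilinear_ext_basis: "set bs \<subseteq> basis \<Longrightarrow> multilinear_ext f bs = f bs"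
  by (induction bs arbitrary: f) (simp_all add: linear_ext_basis)

end

fun inversions :: "('a \<Rightarrow> 'a \<Rightarrow> bool) \<Rightarrow> 'a list \<Rightarrow> nat" where
  "inversions lt [] = 0"
| "inversions lt (a # as) = length (filter (\<lambda>b. lt b a) as) + inversions lt as"

lemma inversions_swap:
  assumes "lt b a" "\<not> lt a b"
  shows "inversions lt (us @ b # a # vs) < inversions lt (us @ a # b # vs)"
  using assms by (induction us) auto

text \<open>
  The negated comparison is what makes swapping a descent lower the number of inversions for an
  arbitrary relation, so that the recursion below terminates without any hypothesis on \<open>lt\<close>.
\<close>

definition descent :: "('a \<Rightarrow> 'a \<Rightarrow> bool) \<Rightarrow> 'a list \<Rightarrow> 'a list \<times> 'a \<times> 'a \<times> 'a list \<Rightarrow> bool" where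
  "descent lt as = (\<lambda>(us, a, b, vs). as = us @ a # b # vs \<and> lt b a \<and> \<not> lt a b)"

text \<open>
  Bubble sort as a reduction to normal form in an enveloping algebra: \<open>a b\<close> with \<open>b < a\<close> is replaced
  by \<open>b a + [a, b]\<close>. The term with the bracket is one shorter and is handed to \<open>g\<close>, a functional already
  known on shorter lists; \<open>\<mu>\<close> gives the values on sorted lists. The descent to be removed is
  chosen arbitrarily.
\<close>

function straighten :: "('a \<Rightarrow> 'a \<Rightarrow> bool) \<Rightarrow> ('a \<Rightarrow> 'a \<Rightarrow> 'a) \<Rightarrow> ('a list \<Rightarrow> 'b::ab_group_add) \<Rightarrow>
    ('a list \<Rightarrow> 'b) \<Rightarrow> 'a list \<Rightarrow> 'b" where
  "straighten lt br \<mu> g as =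
     (if \<exists>d. descent lt as d then
        (case SOME d. descent lt as d of (us, a, b, vs) \<Rightarrow>
           straighten lt br \<mu> g (us @ b # a # vs) + g (us @ br a b # vs))
      else \<mu> as)"
  by pat_completeness auto
termination
proof (relation "measure (\<lambda>(lt, br, \<mu>, g, as). inversions lt as)")
  fix lt br \<mu> g and as :: "'a list" and x us z a b vs
  assume "Ex (descent lt as)" "(us, x) = Eps (descent lt as)" "(a, z) = x" "(b, vs) = z"
  then have "descent lt as (us, a, b, vs)" by (metis someI_ex)
  then show "((lt, br, \<mu>, g, us @ b # a # vs), lt, br, \<mu>, g, as) \<in> measure (\<lambda>(lt, br, \<mu>, g, as). inversions lt as)"
    by (auto simp: descent_def inversions_swap)
qed simp

declare straighten.simps [simp del]

text \<open>
  The right-hand side of the straightening rule at one given descent. With \<open>h\<close> the straightening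
  itself, confluence says that this does not depend on the descent.
\<close>

definition resolve :: "('a \<Rightarrow> 'a \<Rightarrow> 'a) \<Rightarrow> ('a list \<Rightarrow> 'b::ab_group_add) \<Rightarrow> ('a list \<Rightarrow> 'b) \<Rightarrow>
    'a list \<times> 'a \<times> 'a \<times> 'a list \<Rightarrow> 'b" where
  "resolve br h g = (\<lambda>(us, a, b, vs). h (us @ b # a # vs) + g (us @ br a b # vs))"

lemma straighten_cases:
  obtains (sorted) "\<nexists>d. descent lt as d" "straighten lt br \<mu> g as = \<mu> as"
  | (descent) d where "descent lt as d"
      "straighten lt br \<mu> g as = resolve br (straighten lt br \<mu> g) g d"
proof (cases "\<exists>d. descent lt as d")
  case True
  then have "descent lt as (SOME d. descent lt as d)" by (rule someI_ex)
  moreover have "straighten lt br \<mu> g as = resolve br (straighten lt br \<mu> g) g (SOME d. descent lt as d)"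
    using True by (subst straighten.simps) (simp add: resolve_def split: prod.splits)
  ultimately show ?thesis by (rule descent)
next
  case False
  then show ?thesis using straighten.simps[of lt br \<mu> g as] sorted by simp
qed

context lie_algebra
begin

text \<open>
  The diamond lemma for enveloping algebras. It suffices to compare two descents of the same list,
  since all lists obtained on the way have fewer inversions. Disjoint descents can be removed in
  either order, and the bracket terms agree by the commutation rule for \<open>g\<close>. For overlapping
  descents \<open>a b c\<close> both reductions arrive at \<open>c b a\<close>, and the bracket terms that they
  collect agree by the Jacobi identity. The map \<open>g'\<close> is the functional on lists one shorter still.
\<close>

lemma straighten_descent:
  fixes lt :: "'a \<Rightarrow> 'a \<Rightarrow> bool" and \<mu> g g' :: "'a list \<Rightarrow> 'a"
  assumes asym: "\<And>a b. lt a b \<Longrightarrow> \<not> lt b a" and trans: "\<And>a b c. lt a b \<Longrightarrow> lt b c \<Longrightarrow> lt a c"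
    and g': "\<And>us a b vs. Suc (Suc (length us + length vs)) = n \<Longrightarrow>
               g (us @ a # b # vs) = g (us @ b # a # vs) + g' (us @ bracket a b # vs)"
    and g'_multilinear: "multilinear g'"
    and "as = us @ a # b # vs" "lt b a" "length as = Suc n"
  defines "h \<equiv> straighten lt bracket \<mu> g"
  shows "h as = resolve bracket h g (us, a, b, vs)"
  using assms(5-7)
proof (induction "inversions lt as" arbitrary: as us a b vs rule: less_induct)
  case less
  have IH: "h (us' @ x # y # vs') = h (us' @ y # x # vs') + g (us' @ bracket x y # vs')"
    if "lt y x" "inversions lt (us' @ x # y # vs') < inversions lt as"
      "length us' + length vs' + 2 = Suc n" for us' x y vs'
    using less.hyps[OF that(2) refl that(1)] that(3) by (simp add: resolve_def)
  have swap: "inversions lt (us' @ y # x # vs') < inversions lt (us' @ x # y # vs')"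
    if "lt y x" for us' x y vs'
    using that asym by (auto intro: inversions_swap)
  have confluent: "resolve bracket h g (us, a, b, vs) = resolve bracket h g (us', a', b', vs')"
    if eq: "as = us @ a # b # vs" "as = us' @ a' # b' # vs'" and lt: "lt b a" "lt b' a'"
      and len: "length us \<le> length us'"
    for us a b vs us' a' b' vs'
  proof -
    from eq len obtain ms where ms: "us' = us @ ms" "a # b # vs = ms @ a' # b' # vs'"
      by (auto simp: append_eq_append_conv2)
    consider "ms = []" | "ms = [a]" "a' = b" "vs = b' # vs'"
      | ks where "ms = a # b # ks" "vs = ks @ a' # b' # vs'"
      using ms(2) by (cases ms; cases "tl ms") auto
    then show ?thesis
    proof cases
      case 1
      with ms show ?thesis by simp
    next
      case 2
      define c where "c = b'"
      have as: "as = us @ a # b # c # vs'" and us': "us' = us @ [a]" and ba: "lt b a" and cb: "lt c b"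
        using eq(1) ms 2 lt by (simp_all add: c_def)
      have ca: "lt c a" using trans[OF cb ba] .
      have len: "Suc (length us + length vs' + 2) = Suc n"
        using less.prems(3) as by simp
      have s1: "inversions lt (us @ b # a # c # vs') < inversions lt as"
        unfolding as by (rule swap[OF ba])
      have s2: "inversions lt (us @ b # c # a # vs') < inversions lt as"
        using swap[OF ca, of "us @ [b]" vs'] s1 by simp
      have s3: "inversions lt (us @ a # c # b # vs') < inversions lt as"
        using swap[OF cb, of "us @ [a]" vs'] as by simp
      have s4: "inversions lt (us @ c # a # b # vs') < inversions lt as"
        using swap[OF ca, of us "b # vs'"] s3 by simp
      have "h (us @ b # a # c # vs') = h (us @ b # c # a # vs') + g (us @ b # bracket a c # vs')"
        using IH[OF ca, of "us @ [b]" vs'] s1 len by simp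
      moreover have "h (us @ b # c # a # vs') = h (us @ c # b # a # vs') + g (us @ bracket b c # a # vs')"
        using IH[OF cb, of us "a # vs'"] s2 len by simp
      moreover have "h (us @ a # c # b # vs') = h (us @ c # a # b # vs') + g (us @ bracket a c # b # vs')"
        using IH[OF ca, of us "b # vs'"] s3 len by simp
      moreover have "h (us @ c # a # b # vs') = h (us @ c # b # a # vs') + g (us @ c # bracket a b # vs')"
        using IH[OF ba, of "us @ [c]" vs'] s4 len by simp
      moreover have "g (us @ bracket b c # a # vs') + g (us @ b # bracket a c # vs') + g (us @ bracket a b # c # vs')
          = g (us @ c # bracket a b # vs') + g (us @ bracket a c # b # vs') + g (us @ a # bracket b c # vs')"
      proof -
        have "g (us @ bracket b c # a # vs') = g (us @ a # bracket b c # vs') + g' (us @ bracket (bracket b c) a # vs')"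
          "g (us @ b # bracket a c # vs') = g (us @ bracket a c # b # vs') + g' (us @ bracket b (bracket a c) # vs')"
          "g (us @ bracket a b # c # vs') = g (us @ c # bracket a b # vs') + g' (us @ bracket (bracket a b) c # vs')"
          using len by (auto intro!: g')
        moreover have "g' (us @ bracket (bracket b c) a # vs') + g' (us @ bracket b (bracket a c) # vs')
            + g' (us @ bracket (bracket a b) c # vs') = 0"
        proof -
          have "bracket (bracket b c) a + bracket b (bracket a c) + bracket (bracket a b) c =
              - (bracket a (bracket b c) + bracket b (bracket c a) + bracket c (bracket a b))"
            using bracket_skew[of "bracket b c" a] bracket_skew[of "bracket a b" c] bracket_skew[of a c]
            by (simp add: bracket_minus_right)
          also have "\<dots> = 0" by (simp add: jacobi)
          finally have "bracket (bracket b c) a + bracket b (bracket a c) + bracket (bracket a b) c = 0" .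
          then show ?thesis
            by (simp flip: multilinear_add[OF g'_multilinear] add: multilinear_zero[OF g'_multilinear])
        qed
        ultimately show ?thesis by (simp add: algebra_simps)
      qed
      ultimately show ?thesis
        using 2 us' by (simp add: resolve_def c_def algebra_simps)
    next
      case 3
      have as: "as = us @ a # b # ks @ a' # b' # vs'" and us': "us' = us @ a # b # ks"
        using eq ms 3 by simp_all
      have len: "length us + length ks + length vs' + 4 = Suc n"
        using less.prems(3) as by simp
      have s1: "inversions lt (us @ b # a # ks @ a' # b' # vs') < inversions lt as"
        unfolding as by (rule swap[OF lt(1)])
      have s2: "inversions lt (us @ a # b # ks @ b' # a' # vs') < inversions lt as"
        using swap[OF lt(2), of "us @ a # b # ks" vs'] as by simp
      have "h (us @ b # a # ks @ a' # b' # vs') =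
          h (us @ b # a # ks @ b' # a' # vs') + g (us @ b # a # ks @ bracket a' b' # vs')"
        using IH[OF lt(2), of "us @ b # a # ks" vs'] s1 len by simp
      moreover have "h (us @ a # b # ks @ b' # a' # vs') =
          h (us @ b # a # ks @ b' # a' # vs') + g (us @ bracket a b # ks @ b' # a' # vs')"
        using IH[OF lt(1), of us "ks @ b' # a' # vs'"] s2 len by simp
      moreover have "g (us @ bracket a b # ks @ a' # b' # vs') =
          g (us @ bracket a b # ks @ b' # a' # vs') + g' (us @ bracket a b # ks @ bracket a' b' # vs')"
        using g'[of "us @ bracket a b # ks" vs' a' b'] len by simp
      moreover have "g (us @ a # b # ks @ bracket a' b' # vs') =
          g (us @ b # a # ks @ bracket a' b' # vs') + g' (us @ bracket a b # ks @ bracket a' b' # vs')"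
        using g'[of us "ks @ bracket a' b' # vs'" a b] len by simp
      ultimately show ?thesis
        using 3 us' by (simp add: resolve_def algebra_simps)
    qed
  qed
  show ?case
  proof (cases rule: straighten_cases[where lt = lt and as = as and br = bracket and \<mu> = \<mu> and g = g])
    case sorted
    then show ?thesis using less.prems asym by (auto simp: descent_def)
  next
    case (descent d)
    obtain us' a' b' vs' where d: "d = (us', a', b', vs')" by (cases d)
    then have d': "as = us' @ a' # b' # vs'" "lt b' a'" using descent by (auto simp: descent_def)
    have "resolve bracket h g (us, a, b, vs) = resolve bracket h g (us', a', b', vs')"
      using confluent[OF less.prems(1) d'(1) less.prems(2) d'(2)]
        confluent[OF d'(1) less.prems(1) d'(2) less.prems(2)] by (metis nat_le_linear)
    then show ?thesis using descent d by (simp add: h_def)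
  qed
qed

end

lemma strict_linear_order_exists:
  obtains lt :: "'a \<Rightarrow> 'a \<Rightarrow> bool"
  where "\<And>a b. lt a b \<Longrightarrow> \<not> lt b a" "\<And>a b c. lt a b \<Longrightarrow> lt b c \<Longrightarrow> lt a c"
    "\<And>a b. a \<noteq> b \<Longrightarrow> lt a b \<or> lt b a"
proof -
  obtain r :: "('a \<times> 'a) set" where "Well_order r" "Field r = UNIV"
    using well_ordering[where 'a = 'a] by (elim exE conjE)
  then have r: "trans r" "antisym r" "total r"
    by (auto simp: well_order_on_def linear_order_on_def partial_order_on_def preorder_on_def)
  show ?thesis
  proof (rule that[of "\<lambda>a b. (a, b) \<in> r \<and> a \<noteq> b"])
    fix a b c :: 'a
    show "\<not> ((b, a) \<in> r \<and> b \<noteq> a)" if "(a, b) \<in> r \<and> a \<noteq> b"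
      using that r(2) by (auto dest: antisymD)
    show "(a, c) \<in> r \<and> a \<noteq> c" if "(a, b) \<in> r \<and> a \<noteq> b" "(b, c) \<in> r \<and> b \<noteq> c"
      using that r(1,2) by (metis antisymD transD)
    show "((a, b) \<in> r \<and> a \<noteq> b) \<or> ((b, a) \<in> r \<and> b \<noteq> a)" if "a \<noteq> b"
      using that r(3) by (auto simp: total_on_def)
  qed
qed

context lie_algebra
begin

lemma multilinear_context:
  assumes "multilinear f"
  shows "multilinear (\<lambda>as. f (us @ as @ vs))"
  using multilinear_add[OF assms, of "us @ _" _ _ "_ @ vs"]
    multilinear_scale[OF assms, of "us @ _" _ _ "_ @ vs"]
  by (simp add: multilinear_def)

lemma multilinear_map:
  assumes "multilinear f" "\<And>a b. h (a + b) = h a + h b" "\<And>c a. h (scale c a) = scale c (h a)"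
  shows "multilinear (\<lambda>as. f (us @ map h as @ vs))"
  using multilinear_context[OF assms(1), of us vs] assms(2,3) by (simp add: multilinear_def)

lemma multilinear_plus: "multilinear f \<Longrightarrow> multilinear g \<Longrightarrow> multilinear (\<lambda>as. f as + g as)"
  by (simp add: multilinear_def scale_right_distrib)

text \<open>
  Stage \<open>n\<close> is meaningful on lists of length \<open>n\<close> only. Straightening takes place on lists of basis
  elements, but a bracket of basis elements is not a basis element, so that each stage has to
  be extended multilinearly before the next one can use it.
\<close>

primrec stage :: "('a \<Rightarrow> 'a \<Rightarrow> bool) \<Rightarrow> ('a list \<Rightarrow> 'a) \<Rightarrow> nat \<Rightarrow> 'a list \<Rightarrow> 'a" where
  "stage lt \<mu> 0 = multilinear_ext \<mu>"
| "stage lt \<mu> (Suc n) = multilinear_ext (straighten lt bracket \<mu> (stage lt \<mu> n))"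

lemma multilinear_stage: "multilinear (stage lt \<mu> n)"
  by (cases n) (simp_all add: multilinear_multilinear_ext)

text \<open>
  All terms are linear in every entry, so the entries can be released from the basis one slot at
  a time: first \<open>vs\<close>, then \<open>b\<close>, \<open>a\<close> and \<open>us\<close>.
\<close>

lemma commutation_from_basis:
  assumes S: "multilinear S" and T: "multilinear T"
    and basis: "\<And>us a b vs. length us + length vs = n \<Longrightarrow> set us \<subseteq> basis \<Longrightarrow> a \<in> basis \<Longrightarrow> b \<in> basis \<Longrightarrow>
      set vs \<subseteq> basis \<Longrightarrow> S (us @ a # b # vs) = S (us @ b # a # vs) + T (us @ bracket a b # vs)"
    and len: "length us + length vs = n"
  shows "S (us @ a # b # vs) = S (us @ b # a # vs) + T (us @ bracket a b # vs)"
proof -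
  note ml = multilinear_context[OF S] multilinear_context[OF T] multilinear_plus
  have 1: "S (us @ a # b # vs) = S (us @ b # a # vs) + T (us @ bracket a b # vs)"
    if "length us + length vs = n" "set us \<subseteq> basis" "a \<in> basis" "b \<in> basis" for us a b vs
  proof (rule multilinear_eqI[OF _ _ span_basis, where as = vs])
    show "multilinear (\<lambda>vs. S (us @ a # b # vs))"
      using ml(1)[of "us @ [a, b]" "[]"] by simp
    show "multilinear (\<lambda>vs. S (us @ b # a # vs) + T (us @ bracket a b # vs))"
      using ml(3)[OF ml(1)[of "us @ [b, a]" "[]"] ml(2)[of "us @ [bracket a b]" "[]"]] by simp
  qed (rule basis, use that in auto)
  have 2: "S (us @ a # b # vs) = S (us @ b # a # vs) + T (us @ bracket a b # vs)"
    if "length us + length vs = n" "set us \<subseteq> basis" "a \<in> basis" for us a b vs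
  proof -
    have "S (us @ a # [b] @ vs) = S (us @ [b] @ a # vs) + T (us @ map (bracket a) [b] @ vs)"
    proof (rule multilinear_eqI[OF _ _ span_basis, where as = "[b]"])
      show "multilinear (\<lambda>w. S (us @ a # w @ vs))"
        using ml(1)[of "us @ [a]" vs] by simp
      show "multilinear (\<lambda>w. S (us @ w @ a # vs) + T (us @ map (bracket a) w @ vs))"
        by (intro ml(3) ml(1) multilinear_map T bracket_add_right bracket_scale_right)
    qed (auto simp: length_Suc_conv intro!: 1 that)
    then show ?thesis by simp
  qed
  have 3: "S (us @ a # b # vs) = S (us @ b # a # vs) + T (us @ bracket a b # vs)"
    if "length us + length vs = n" "set us \<subseteq> basis" for us a b vs
  proof -
    have "S (us @ [a] @ b # vs) = S (us @ b # [a] @ vs) + T (us @ map (\<lambda>x. bracket x b) [a] @ vs)"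
    proof (rule multilinear_eqI[OF _ _ span_basis, where as = "[a]"])
      show "multilinear (\<lambda>w. S (us @ w @ b # vs))"
        by (rule ml(1))
      show "multilinear (\<lambda>w. S (us @ b # w @ vs) + T (us @ map (\<lambda>x. bracket x b) w @ vs))"
        using ml(3)[OF ml(1)[of "us @ [b]" vs]
          multilinear_map[OF T, of "\<lambda>x. bracket x b" us vs, OF bracket_add_left bracket_scale_left]]
        by simp
    qed (auto simp: length_Suc_conv intro!: 2 that)
    then show ?thesis by simp
  qed
  show ?thesis
  proof (rule multilinear_eqI[OF _ _ span_basis, where as = us])
    show "multilinear (\<lambda>us. S (us @ a # b # vs))"
      using ml(1)[of "[]" "a # b # vs"] by simp
    show "multilinear (\<lambda>us. S (us @ b # a # vs) + T (us @ bracket a b # vs))"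
      using ml(3)[OF ml(1)[of "[]" "b # a # vs"] ml(2)[of "[]" "bracket a b # vs"]] by simp
  qed (rule 3, use len in auto)
qed

text \<open>
  On basis elements the case \<open>b < a\<close> is the diamond lemma, the case \<open>a < b\<close> is the same equation read
  backwards because the bracket is skew, and \<open>a = b\<close> holds since \<open>[a, a] = 0\<close>.
\<close>

lemma stage_commutation:
  assumes lt: "\<And>a b. lt a b \<Longrightarrow> \<not> lt b a" "\<And>a b c. lt a b \<Longrightarrow> lt b c \<Longrightarrow> lt a c"
    "\<And>a b. a \<noteq> b \<Longrightarrow> lt a b \<or> lt b a"
    and "Suc (length us + length vs) = n"
  shows "stage lt \<mu> (Suc n) (us @ a # b # vs) =
    stage lt \<mu> (Suc n) (us @ b # a # vs) + stage lt \<mu> n (us @ bracket a b # vs)"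
  using assms(4)
proof (induction n arbitrary: us a b vs)
  case 0
  then show ?case by simp
next
  case (Suc n)
  have lower: "stage lt \<mu> (Suc n) (us @ a # b # vs) =
      stage lt \<mu> (Suc n) (us @ b # a # vs) + stage lt \<mu> n (us @ bracket a b # vs)"
    if "Suc (Suc (length us + length vs)) = Suc n" for us a b vs
    using that by (intro Suc.IH) simp
  have descent: "stage lt \<mu> (Suc (Suc n)) (us @ a # b # vs) =
      stage lt \<mu> (Suc (Suc n)) (us @ b # a # vs) + stage lt \<mu> (Suc n) (us @ bracket a b # vs)"
    if "length us + length vs = n" "set us \<subseteq> basis" "a \<in> basis" "b \<in> basis" "set vs \<subseteq> basis" "lt b a"
    for us a b vs
  proof -
    have "straighten lt bracket \<mu> (stage lt \<mu> (Suc n)) (us @ a # b # vs) =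
        resolve bracket (straighten lt bracket \<mu> (stage lt \<mu> (Suc n))) (stage lt \<mu> (Suc n)) (us, a, b, vs)"
      by (rule straighten_descent[where lt = lt and n = "Suc n" and g = "stage lt \<mu> (Suc n)" and g' = "stage lt \<mu> n",
        OF lt(1,2) lower multilinear_stage refl that(6)]) (use that in auto)
    moreover have "stage lt \<mu> (Suc (Suc n)) bs = straighten lt bracket \<mu> (stage lt \<mu> (Suc n)) bs"
      if "set bs \<subseteq> basis" for bs
      unfolding stage.simps(2)[of _ _ "Suc n"] using that by (rule multilinear_ext_basis)
    ultimately show ?thesis
      using that by (simp add: resolve_def del: stage.simps)
  qed
  show ?case
  proof (rule commutation_from_basis[OF multilinear_stage multilinear_stage])
    fix us a b vs
    assume *: "length us + length vs = n" "set us \<subseteq> basis" "a \<in> basis" "b \<in> basis" "set vs \<subseteq> basis"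
    consider "lt b a" | "lt a b" | "a = b" using lt(3) by blast
    then show "stage lt \<mu> (Suc (Suc n)) (us @ a # b # vs) =
      stage lt \<mu> (Suc (Suc n)) (us @ b # a # vs) + stage lt \<mu> (Suc n) (us @ bracket a b # vs)"
    proof cases
      case 1
      with * show ?thesis by (intro descent)
    next
      case 2
      with * have "stage lt \<mu> (Suc (Suc n)) (us @ b # a # vs) =
          stage lt \<mu> (Suc (Suc n)) (us @ a # b # vs) + stage lt \<mu> (Suc n) (us @ bracket b a # vs)"
        by (intro descent)
      moreover have "stage lt \<mu> (Suc n) (us @ bracket b a # vs) = - stage lt \<mu> (Suc n) (us @ bracket a b # vs)"
        using bracket_skew[of b a] multilinear_minus[OF multilinear_stage] by (simp del: stage.simps)
      ultimately show ?thesis by (simp del: stage.simps(2))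
    next
      case 3
      then show ?thesis by (simp add: bracket_self multilinear_zero[OF multilinear_stage] del: stage.simps(2))
    qed
  qed (use Suc.prems in auto)
qed

text \<open>
  These are the linear maps from the enveloping algebra of the Lie algebra to its underlying vector
  space, given by their values on products of elements of the Lie algebra.
\<close>

definition enveloping_functional :: "('a list \<Rightarrow> 'a) \<Rightarrow> bool" where
  "enveloping_functional \<sigma> \<longleftrightarrow> multilinear \<sigma> \<and>
     (\<forall>us a b vs. \<sigma> (us @ a # b # vs) = \<sigma> (us @ b # a # vs) + \<sigma> (us @ bracket a b # vs))"

lemma enveloping_functional_commutation:
  assumes "enveloping_functional \<sigma>"
  shows "\<sigma> (us @ a # b # vs) - \<sigma> (us @ b # a # vs) = \<sigma> (us @ bracket a b # vs)"
  using assms unfolding enveloping_functional_def by (metis add_diff_cancel_left')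

lemma enveloping_functional_multilinear: "enveloping_functional \<sigma> \<Longrightarrow> multilinear \<sigma>"
  by (simp add: enveloping_functional_def)

text \<open>
  The Poincare-Birkhoff-Witt theorem in the form in which it is used: a symmetric multilinear map is
  the leading term of a functional. Straightening with the values \<open>\<mu>\<close> on sorted lists gives the
  functional. Below length \<open>N\<close> it vanishes with \<open>\<mu>\<close>, hence at length \<open>N\<close> the bracket
  terms do not contribute and sorting only uses the symmetry of \<open>\<mu>\<close>.
\<close>

theorem enveloping_functional_exists:
  assumes \<mu>: "multilinear \<mu>"
    and symmetric: "\<And>us a b vs. \<mu> (us @ a # b # vs) = \<mu> (us @ b # a # vs)"
    and zero: "\<And>as. length as < N \<Longrightarrow> \<mu> as = 0"
  obtains \<sigma> where "enveloping_functional \<sigma>" "\<And>as. length as \<le> N \<Longrightarrow> \<sigma> as = \<mu> as"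
proof (rule strict_linear_order_exists)
  fix lt :: "'a \<Rightarrow> 'a \<Rightarrow> bool"
  assume lt: "\<And>a b. lt a b \<Longrightarrow> \<not> lt b a"
    "\<And>a b c. lt a b \<Longrightarrow> lt b c \<Longrightarrow> lt a c" "\<And>a b. a \<noteq> b \<Longrightarrow> lt a b \<or> lt b a"
  define \<sigma> where "\<sigma> as = stage lt \<mu> (length as) as" for as
  have straighten: "straighten lt bracket \<mu> g as = \<mu> as"
    if "length as = n" and g: "\<And>cs. Suc (length cs) = n \<Longrightarrow> g cs = 0" for g as n
    using that(1)
  proof (induction "inversions lt as" arbitrary: as rule: less_induct)
    case less
    show ?case
    proof (cases rule: straighten_cases[where lt = lt and as = as and br = bracket and \<mu> = \<mu> and g = g])
      case (descent d)
      obtain us a b vs where d: "as = us @ a # b # vs" "lt b a" "\<not> lt a b" "d = (us, a, b, vs)"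
        using descent(1) by (auto simp: descent_def)
      have "straighten lt bracket \<mu> g as = straighten lt bracket \<mu> g (us @ b # a # vs)"
        using descent(2) d less.prems by (simp add: resolve_def g)
      also have "\<dots> = \<mu> (us @ b # a # vs)"
        using less.hyps[of "us @ b # a # vs"] less.prems d inversions_swap[of lt b a us vs] by simp
      also have "\<dots> = \<mu> as"
        using symmetric d(1) by simp
      finally show ?thesis .
    qed
  qed
  have "stage lt \<mu> n as = \<mu> as" if "length as = n" "n \<le> N" for n as
    using that
  proof (induction n arbitrary: as)
    case 0
    then show ?case by simp
  next
    case (Suc n)
    have "straighten lt bracket \<mu> (stage lt \<mu> n) bs = \<mu> bs" if "length bs = Suc n" for bs
      using that by (rule straighten) (use Suc zero in auto)
    then have "stage lt \<mu> (Suc n) bs = \<mu> bs" if "set bs \<subseteq> basis" "length bs = length as" for bs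
      using that Suc.prems by (simp add: multilinear_ext_basis)
    then show ?case by (rule multilinear_eqI[OF multilinear_stage \<mu> span_basis])
  qed
  then have "\<sigma> as = \<mu> as" if "length as \<le> N" for as
    using that by (simp add: \<sigma>_def)
  moreover have "enveloping_functional \<sigma>"
    unfolding enveloping_functional_def
  proof (intro conjI allI)
    show "multilinear \<sigma>"
      using multilinear_add[OF multilinear_stage] multilinear_scale[OF multilinear_stage]
      by (simp add: multilinear_def \<sigma>_def del: stage.simps)
    fix us a b vs
    show "\<sigma> (us @ a # b # vs) = \<sigma> (us @ b # a # vs) + \<sigma> (us @ bracket a b # vs)"
      using stage_commutation[OF lt, where us = us and vs = vs and a = a and b = b and \<mu> = \<mu>]
      by (simp add: \<sigma>_def del: stage.simps)
  qed
  ultimately show ?thesis by (rule that[rotated])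
qed

end


section \<open>Evaluating tensors in the enveloping algebra\<close>

lemma tensor_induct [case_names zero single add]:
  fixes P :: "'k::field tensor \<Rightarrow> bool"
  assumes zero: "P 0" and single: "\<And>w c. P (Poly_Mapping.single w c)"
    and add: "\<And>a b. P a \<Longrightarrow> P b \<Longrightarrow> P (a + b)"
  shows "P a"
proof (induction a rule: Poly_Mapping.update_induct)
  case const
  show ?case by (rule zero)
next
  case (update f w d)
  then have "Poly_Mapping.update w d f = f + Poly_Mapping.single w d"
    by (intro poly_mapping_eqI)
      (auto simp: lookup_update lookup_add lookup_single when_def in_keys_iff)
  with update show ?case by (simp add: add single)
qed

lemma lookup_tscale: "Poly_Mapping.lookup (tscale c a) w = c * Poly_Mapping.lookup a w"
  by (induction a rule: tensor_induct)
    (simp_all add: tscale_def tscalar_def mult_single lookup_add distrib_left lookup_single when_def)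

context lie_algebra
begin

text \<open>
  Sending the generators to \<open>e GX\<close> and \<open>e GY\<close> defines an algebra map from \<open>T(V)\<close> to the enveloping
  algebra. The pairing is the value of \<open>\<sigma>\<close> at the image of \<open>t\<close>, multiplied by \<open>us\<close> on the left and by
  \<open>vs\<close> on the right.
\<close>

definition pairing :: "(gen \<Rightarrow> 'a) \<Rightarrow> ('a list \<Rightarrow> 'a) \<Rightarrow> 'a list \<Rightarrow> 'k tensor \<Rightarrow> 'a list \<Rightarrow> 'a" where
  "pairing e \<sigma> us t vs =
     (\<Sum>w\<in>Poly_Mapping.keys t. scale (Poly_Mapping.lookup t w) (\<sigma> (us @ map e (letters w) @ vs)))"

lemma pairing_superset:
  assumes "finite S" "Poly_Mapping.keys t \<subseteq> S"
  shows "pairing e \<sigma> us t vs =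
    (\<Sum>w\<in>S. scale (Poly_Mapping.lookup t w) (\<sigma> (us @ map e (letters w) @ vs)))"
  unfolding pairing_def
  by (rule sum.mono_neutral_left) (use assms in \<open>auto simp: in_keys_iff\<close>)

lemma pairing_add: "pairing e \<sigma> us (s + t) vs = pairing e \<sigma> us s vs + pairing e \<sigma> us t vs"
proof -
  let ?S = "Poly_Mapping.keys s \<union> Poly_Mapping.keys t"
  have S: "finite ?S" "Poly_Mapping.keys (s + t) \<subseteq> ?S" by (simp_all add: Poly_Mapping.keys_add)
  show ?thesis
    by (simp add: pairing_superset[OF S] pairing_superset[OF S(1)] lookup_add scale_left_distrib sum.distrib)
qed

lemma pairing_scale: "pairing e \<sigma> us (tscale c t) vs = scale c (pairing e \<sigma> us t vs)"
proof -
  have "Poly_Mapping.keys (tscale c t) \<subseteq> Poly_Mapping.keys t"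
    by (auto simp: in_keys_iff lookup_tscale)
  then show ?thesis
    by (simp add: pairing_superset[of "Poly_Mapping.keys t"] lookup_tscale scale_sum_right)
qed

lemma pairing_zero: "pairing e \<sigma> us 0 vs = 0"
  by (simp add: pairing_def)

lemma pairing_single:
  "pairing e \<sigma> us (Poly_Mapping.single w c) vs = scale c (\<sigma> (us @ map e (letters w) @ vs))"
  by (simp add: pairing_superset[of "{w}"])

lemma pairing_diff: "pairing e \<sigma> us (s - t) vs = pairing e \<sigma> us s vs - pairing e \<sigma> us t vs"
  using pairing_add[of e \<sigma> us "s - t" t vs] by simp

lemma pairing_mult_single:
  "pairing e \<sigma> us (t * Poly_Mapping.single w c) vs = scale c (pairing e \<sigma> us t (map e (letters w) @ vs))"
  by (induction t rule: tensor_induct)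
    (simp_all add: pairing_zero pairing_single pairing_add distrib_right mult_single plus_word_def
      scale_right_distrib mult.commute)

text \<open>
  The image of \<open>l\<close> in the enveloping algebra is the single element \<open>a\<close> of the Lie algebra, as
  far as functionals can see.
\<close>

definition represents :: "(gen \<Rightarrow> 'a) \<Rightarrow> 'k tensor \<Rightarrow> 'a \<Rightarrow> bool" where
  "represents e l a \<longleftrightarrow>
     (\<forall>\<sigma> us vs. enveloping_functional \<sigma> \<longrightarrow> pairing e \<sigma> us l vs = \<sigma> (us @ a # vs))"

lemma pairing_represents_mult:
  assumes "represents e l a" "enveloping_functional \<sigma>"
  shows "pairing e \<sigma> us (l * t) vs = pairing e \<sigma> (us @ [a]) t vs"
  using assms
  by (induction t rule: tensor_induct)
    (simp_all add: represents_def pairing_zero pairing_single pairing_add distrib_left pairing_mult_single)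

lemma represents_comm:
  assumes "represents e l a" "represents e m b"
  shows "represents e (comm l m) (bracket a b)"
  unfolding represents_def
proof (intro allI impI)
  fix \<sigma> us vs
  assume \<sigma>: "enveloping_functional \<sigma>"
  have "pairing e \<sigma> us (comm l m) vs = \<sigma> (us @ a # b # vs) - \<sigma> (us @ b # a # vs)"
    using assms \<sigma> by (simp add: comm_def pairing_diff pairing_represents_mult)
      (simp add: represents_def)
  also have "\<dots> = \<sigma> (us @ bracket a b # vs)"
    by (rule enveloping_functional_commutation[OF \<sigma>])
  finally show "pairing e \<sigma> us (comm l m) vs = \<sigma> (us @ bracket a b # vs)" .
qed

lemma represents_gen: "represents e (tgen g) (e g)"
  by (simp add: represents_def tgen_def pairing_single)

text \<open>
  The subspace of elements of the enveloping algebra that come from the Lie algebra is closed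
  under commutators. This is where freeness of \<open>free_lie\<close> comes from: being a representative
  refers to the tensor \<open>l\<close> only, and not to the way in which \<open>l\<close> is written with commutators, and
  a functional that is the identity on single elements determines \<open>a\<close>.
\<close>

lemma free_lie_represents: "l \<in> free_lie \<Longrightarrow> \<exists>a. represents e l a"
proof (induction rule: free_lie.induct)
  case (gen g)
  show ?case using represents_gen by blast
next
  case (add l m)
  then obtain a b where "represents e l a" "represents e m b" by blast
  then have "represents e (l + m) (a + b)"
    by (simp add: represents_def pairing_add multilinear_add enveloping_functional_multilinear)
  then show ?case by blast
next
  case (scale l c)
  then obtain a where "represents e l a" by blast
  then have "represents e (tscale c l) (scale c a)"
    by (simp add: represents_def pairing_scale multilinear_scale enveloping_functional_multilinear)
  then show ?case by blast
next
  case (comm l m)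
  then show ?case using represents_comm by blast
qed

lemma pairing_prod_list:
  assumes "enveloping_functional \<sigma>" "\<And>l. l \<in> set ls \<Longrightarrow> represents e l (\<psi> l)"
  shows "pairing e \<sigma> us (prod_list ls) vs = \<sigma> (us @ map \<psi> ls @ vs)"
  using assms(2)
proof (induction ls arbitrary: us)
  case Nil
  have "pairing e \<sigma> us (Poly_Mapping.single 0 1) vs = \<sigma> (us @ vs)"
    by (simp add: pairing_single zero_word_def)
  then show ?case by simp
next
  case (Cons l ls)
  then show ?case using pairing_represents_mult[OF Cons.prems[of l] assms(1)] by simp
qed

end

context poisson_algebra
begin

lemma scale_mult_right: "x * scale c y = scale c (x * y)"
  using scale_mult_left[of c y x] by (simp add: mult.commute)

definition top_functional :: "nat \<Rightarrow> 'a list \<Rightarrow> 'a" where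
  "top_functional n = (SOME \<sigma>. enveloping_functional \<sigma> \<and>
     (\<forall>as. length as \<le> n \<longrightarrow> \<sigma> as = (if length as = n then prod_list as else 0)))"

lemma top_functional:
  shows enveloping_functional_top: "enveloping_functional (top_functional n)"
    and top_functional_le:
      "length as \<le> n \<Longrightarrow> top_functional n as = (if length as = n then prod_list as else 0)"
proof -
  let ?\<mu> = "\<lambda>as. if length as = n then prod_list as else (0 :: 'a)"
  have "multilinear ?\<mu>"
    by (simp add: multilinear_def algebra_simps scale_mult_left scale_mult_right)
  moreover have "?\<mu> (us @ a # b # vs) = ?\<mu> (us @ b # a # vs)" for us a b vs
    by (simp add: mult.left_commute)
  ultimately obtain \<sigma> where "enveloping_functional \<sigma>" "\<And>as. length as \<le> n \<Longrightarrow> \<sigma> as = ?\<mu> as"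
    by (rule enveloping_functional_exists[where N = n]) auto
  then have "\<exists>\<sigma>. enveloping_functional \<sigma> \<and> (\<forall>as. length as \<le> n \<longrightarrow> \<sigma> as = ?\<mu> as)" by blast
  then have *: "enveloping_functional (top_functional n) \<and> (\<forall>as. length as \<le> n \<longrightarrow> top_functional n as = ?\<mu> as)"
    unfolding top_functional_def by (rule someI_ex)
  show "enveloping_functional (top_functional n)" using * by blast
  show "length as \<le> n \<Longrightarrow> top_functional n as = (if length as = n then prod_list as else 0)" using * by blast
qed

text \<open>
  On \<open>F\<^sub>n\<close> this is the component \<open>F\<^sub>n / F\<^sub>n\<^sub>-\<^sub>1 \<rightarrow> A\<close> of the morphism that is being
  constructed; on \<open>free_lie\<close>, with \<open>n = 1\<close>, it is the Lie algebra map to \<open>A\<close>.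
\<close>

definition top_value :: "(gen \<Rightarrow> 'a) \<Rightarrow> nat \<Rightarrow> 'k tensor \<Rightarrow> 'a" where
  "top_value e n t = pairing e (top_functional n) [] t []"

lemma top_value_add: "top_value e n (s + t) = top_value e n s + top_value e n t"
  and top_value_diff: "top_value e n (s - t) = top_value e n s - top_value e n t"
  and top_value_scale: "top_value e n (tscale c t) = scale c (top_value e n t)"
  by (simp_all add: top_value_def pairing_add pairing_diff pairing_scale)

lemma represents_top_value: "l \<in> free_lie \<Longrightarrow> represents e l (top_value e 1 l)"
proof -
  assume "l \<in> free_lie"
  then obtain a where a: "represents e l a" using free_lie_represents by blast
  then have "top_value e 1 l = a"
    using enveloping_functional_top[of 1] by (simp add: represents_def top_value_def top_functional_le)
  with a show ?thesis by simp
qed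

lemma top_value_prod_list:
  assumes "length ls \<le> n" "set ls \<subseteq> free_lie"
  shows "top_value e n (prod_list ls) = (if length ls = n then prod_list (map (top_value e 1) ls) else 0)"
proof -
  have "represents e l (top_value e 1 l)" if "l \<in> set ls" for l
    using that assms(2) represents_top_value by blast
  then have "top_value e n (prod_list ls) = top_functional n (map (top_value e 1) ls)"
    using pairing_prod_list[OF enveloping_functional_top, of ls e "top_value e 1" n "[]" "[]"]
    by (simp add: top_value_def[of e n])
  then show ?thesis using assms(1) by (simp add: top_functional_le)
qed

lemma top_value_pred: "t \<in> pbw_pred n \<Longrightarrow> top_value e n t = 0"
proof (cases n)
  case 0
  then show "t \<in> pbw_pred n \<Longrightarrow> ?thesis" by (simp add: top_value_def pairing_zero)
next
  case (Suc k)
  assume "t \<in> pbw_pred n"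
  then have "t \<in> pbw k" by (simp add: Suc)
  then show ?thesis
    by (induction rule: pbw_induct) (simp_all add: Suc top_value_prod_list top_value_add top_value_scale)
qed

lemma top_value_mult:
  assumes "s \<in> pbw m" "t \<in> pbw n"
  shows "top_value e (m + n) (s * t) = top_value e m s * top_value e n t"
  using assms(1)
proof (induction rule: pbw_induct)
  case (prod ls)
  from assms(2) show ?case
  proof (induction rule: pbw_induct)
    case (prod ks)
    have "top_value e (m + n) (prod_list (ls @ ks)) =
        (if length (ls @ ks) = m + n then prod_list (map (top_value e 1) (ls @ ks)) else 0)"
      using prod \<open>length ls \<le> m\<close> \<open>set ls \<subseteq> free_lie\<close> by (intro top_value_prod_list) auto
    then show ?case
      using prod \<open>length ls \<le> m\<close> \<open>set ls \<subseteq> free_lie\<close> by (auto simp: top_value_prod_list)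
  qed (simp_all add: distrib_left tscale_mult_right top_value_add top_value_scale scale_mult_right)
qed (simp_all add: distrib_right tscale_mult_left top_value_add top_value_scale scale_mult_left)

lemma top_value_comm_free_lie:
  "l \<in> free_lie \<Longrightarrow> m \<in> free_lie \<Longrightarrow> top_value e 1 (comm l m) = bracket (top_value e 1 l) (top_value e 1 m)"
  using represents_comm[OF represents_top_value represents_top_value, of l m e] enveloping_functional_top[of 1]
  by (simp add: represents_def top_value_def top_functional_le)

lemma leibniz_right: "bracket z (x * y) = x * bracket z y + y * bracket z x"
  using leibniz[of x y z] bracket_skew[of z "x * y"] bracket_skew[of z x] bracket_skew[of z y] by simp

lemma bracket_one_left: "bracket 1 x = 0" and bracket_one_right: "bracket x 1 = 0"
  using leibniz[of 1 1 x] leibniz_right[of x 1 1] by simp_all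

lemma top_value_one: "top_value e n 1 = (if n = 0 then 1 else 0)"
  using top_value_prod_list[of "[]" n e] by auto

text \<open>
  Both sides are derivations in \<open>t\<close>, which reduces the claim to \<open>t \<in> free_lie\<close>; there it says that
  the Lie algebra map respects brackets.
\<close>

lemma top_value_comm_lie_left:
  assumes "l \<in> free_lie" "t \<in> pbw n"
  shows "top_value e n (comm l t) = bracket (top_value e 1 l) (top_value e n t)"
  using assms(2)
proof (induction rule: pbw_induct)
  case (prod ks)
  then show ?case
  proof (induction ks arbitrary: n)
    case Nil
    then show ?case
      by (simp add: comm_def top_value_one top_value_pred pbw_closed bracket_one_right bracket_zero_right)
  next
    case (Cons k ks)
    then obtain j where n: "n = 1 + j" by (cases n) auto
    have k: "k \<in> pbw 1" and ks: "prod_list ks \<in> pbw j"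
      using Cons.prems n free_lie_in_pbw[of k] by (auto intro: prod_list_in_pbw)
    have "comm l (prod_list ks) \<in> pbw j"
      using pbw_comm[OF free_lie_in_pbw[OF assms(1)] ks] by simp
    moreover have "comm l k \<in> pbw 1"
      using assms(1) Cons.prems by (intro free_lie_in_pbw free_lie.comm) auto
    ultimately show ?case
      using Cons n assms(1) k ks
      by (simp add: comm_mult_right top_value_add top_value_mult top_value_comm_free_lie leibniz_right
        mult.commute del: One_nat_def)
  qed
qed (simp_all add: comm_add_right comm_tscale_right top_value_add top_value_scale
    bracket_add_right bracket_scale_right)

lemma top_value_comm:
  assumes "s \<in> pbw m" "t \<in> pbw n" "m + n = Suc k"
  shows "top_value e k (comm s t) = bracket (top_value e m s) (top_value e n t)"
  using assms(1)
proof (induction rule: pbw_induct)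
  case (prod ls)
  then show ?case using assms(3)
  proof (induction ls arbitrary: m k)
    case Nil
    then show ?case
      by (simp add: comm_def top_value_one top_value_pred pbw_closed bracket_one_left bracket_zero_left)
  next
    case (Cons l ls)
    then obtain i where m: "m = 1 + i" by (cases m) auto
    then have k: "k = i + n" using Cons.prems by simp
    have l: "l \<in> free_lie" "l \<in> pbw 1" and ls: "prod_list ls \<in> pbw i"
      using Cons.prems m free_lie_in_pbw[of l] by (auto intro: prod_list_in_pbw)
    have 1: "top_value e k (l * comm (prod_list ls) t) =
        top_value e 1 l * bracket (top_value e i (prod_list ls)) (top_value e n t)"
    \<comment> \<open>For \<open>i + n = 0\<close> no degree remains for the commutator, but then it is a commutator with 1.\<close>
    proof (cases "i + n")
      case 0
      then have "ls = []" using Cons.prems m by simp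
      then show ?thesis
        using 0 by (simp add: comm_def top_value_one top_value_pred pbw_closed bracket_one_left)
    next
      case (Suc j)
      have "comm (prod_list ls) t \<in> pbw j"
        using pbw_comm[OF ls assms(2)] Suc by simp
      then have "top_value e (1 + j) (l * comm (prod_list ls) t) =
          top_value e 1 l * top_value e j (comm (prod_list ls) t)"
        by (rule top_value_mult[OF l(2)])
      then show ?thesis using Cons.IH[of i j] Cons.prems m Suc k by simp
    qed
    have "comm l t \<in> pbw n"
      using pbw_comm[OF l(2) assms(2)] by simp
    then have "top_value e k (comm l t * prod_list ls) =
        top_value e n (comm l t) * top_value e i (prod_list ls)"
      using top_value_mult[of "comm l t" n "prod_list ls" i] ls k by (simp add: add.commute)
    with 1 show ?case
      by (simp add: comm_mult_left top_value_add m top_value_mult[OF l(2) ls]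
        top_value_comm_lie_left[OF l(1) assms(2)] leibniz mult.commute del: One_nat_def)
  qed
qed (simp_all add: comm_add_left comm_tscale_left top_value_add top_value_scale
    bracket_add_left bracket_scale_left)

end


section \<open>The universal property of the associated graded algebra\<close>

lemma gr_rel_single: "a \<in> pbw n \<Longrightarrow> gr_rel (Poly_Mapping.single n a) (Poly_Mapping.single n a)"
  by (simp add: gr_rel_def lookup_single when_def pbw_closed)

lemma symbol_add: "a \<in> pbw n \<Longrightarrow> b \<in> pbw n \<Longrightarrow> symbol n (a + b) = symbol n a + symbol n b"
  unfolding symbol_def by (subst plus_free_poisson.abs_eq) (simp_all add: gr_rel_single single_add)

lemma symbol_pred:
  assumes "a \<in> pbw_pred n"
  shows "symbol n a = 0"
proof -
  have "a \<in> pbw n" using assms pbw_pred_subset by blast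
  then have "gr_rel (Poly_Mapping.single n a) 0"
    using assms by (simp add: gr_rel_def lookup_single when_def pbw_closed)
  then show ?thesis
    unfolding symbol_def zero_free_poisson_def by (simp add: Quotient_rel_abs[OF Quotient_free_poisson])
qed

lemma symbol_mult:
  "a \<in> pbw m \<Longrightarrow> b \<in> pbw n \<Longrightarrow> symbol (m + n) (a * b) = symbol m a * symbol n b"
  unfolding symbol_def by (subst times_free_poisson.abs_eq) (simp_all add: gr_rel_single mult_single)

lemma symbol_one: "symbol 0 1 = 1"
  by (simp add: symbol_def one_free_poisson_def)

lemma symbol_tscalar: "symbol 0 (tscalar c) = fp_scalar c"
  by (simp add: symbol_def fp_scalar_def)

lemma tscalar_in_pbw: "tscalar c \<in> pbw 0"
  using tens.subspace_scale[OF subspace_pbw one_in_pbw, of c 0] by (simp add: tscale_def)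

lemma symbol_scale: "a \<in> pbw n \<Longrightarrow> symbol n (tscale c a) = fp_scale c (symbol n a)"
  using symbol_mult[OF tscalar_in_pbw, of a n c] by (simp add: tscale_def fp_scale_def symbol_tscalar)

lemma symbol_diff:
  assumes "a \<in> pbw n" "b \<in> pbw n"
  shows "symbol n (a - b) = symbol n a - symbol n b"
  using symbol_add[of "a - b" n b] assms by (simp add: pbw_closed)

lemma gr_comm_single: "gr_comm (Poly_Mapping.single m a) (Poly_Mapping.single n b) =
    div_t (Poly_Mapping.single (m + n) (comm a b))"
  by (simp add: gr_comm_def comm_def mult_single single_diff add.commute)

lemma symbol_bracket:
  assumes "a \<in> pbw m" "b \<in> pbw n" "m + n = Suc k"
  shows "symbol k (comm a b) = fp_bracket (symbol m a) (symbol n b)"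
proof -
  have "div_t (Poly_Mapping.single (m + n) (comm a b)) = Poly_Mapping.single k (comm a b)"
    by (rule poly_mapping_eqI) (simp add: lookup_single assms(3))
  then show ?thesis
    using assms by (simp add: symbol_def fp_bracket.abs_eq gr_rel_single gr_comm_single)
qed

text \<open>
  Two elements of degree 0 are scalars, and there is no component of degree \<open>-1\<close> for their bracket;
  this is the one case that \<open>symbol_bracket\<close> leaves out.
\<close>

lemma bracket_symbol_0:
  fixes a b :: "'k::field tensor"
  assumes "a \<in> pbw 0" "b \<in> pbw 0"
  shows "fp_bracket (symbol 0 a) (symbol 0 b) = 0"
proof -
  have "div_t (Poly_Mapping.single 0 (comm a b)) = 0"
    by (rule poly_mapping_eqI) (simp add: lookup_single)
  then show ?thesis
    using assms by (simp add: symbol_def fp_bracket.abs_eq gr_rel_single gr_comm_single zero_free_poisson_def)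
qed

lemma free_poisson_induct [case_names symbol add]:
  fixes P :: "'k::field free_poisson \<Rightarrow> bool"
  assumes symbol: "\<And>n a. a \<in> pbw n \<Longrightarrow> P (symbol n a)"
    and add: "\<And>y z. P y \<Longrightarrow> P z \<Longrightarrow> P (y + z)"
  shows "P z"
proof -
  obtain f where f: "gr_rel f f" "z = abs_free_poisson f"
    by (metis Quotient_abs_rep Quotient_free_poisson Quotient_rep_reflp)
  define part where "part S = (\<Sum>n\<in>S. Poly_Mapping.single n (component f n))" for S
  have "gr_rel (part S) (part S) \<and> P (abs_free_poisson (part S))" if "finite S" for S
    using that
  proof (induction S)
    case empty
    have "P (symbol 0 0)" by (rule symbol) (simp add: pbw_closed)
    then show ?case
      by (simp add: part_def symbol_def gr_rel_def pbw_closed)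
  next
    case (insert n S)
    have n: "component f n \<in> pbw n" using f(1) gr_relD by blast
    have "part (insert n S) = Poly_Mapping.single n (component f n) + part S"
      using insert by (simp add: part_def)
    moreover have "abs_free_poisson (Poly_Mapping.single n (component f n) + part S) =
        symbol n (component f n) + abs_free_poisson (part S)"
      using insert n by (simp add: symbol_def plus_free_poisson.abs_eq gr_rel_single)
    ultimately show ?case
      using insert n symbol[OF n] add gr_rel_add[OF gr_rel_single[OF n]] by simp
  qed
  moreover have "part (Poly_Mapping.keys f) = f"
    by (rule poly_mapping_eqI)
      (simp add: part_def lookup_sum lookup_single when_def in_keys_iff)
  ultimately show ?thesis
    using f(2) by (metis finite_keys)
qed

interpretation fp: poisson_algebra fp_scale fp_bracket
  by (rule poisson_algebra_free_poisson)

text \<open>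
  The associated graded algebra is generated, as a Poisson algebra, by the two generators: symbols
  of degree 1 of elements of \<open>free_lie\<close> are iterated brackets, and all other symbols are linear
  combinations of their products.
\<close>

lemma poisson_hom_eqI:
  fixes \<phi> \<chi> :: "'k::field free_poisson \<Rightarrow> 'a::{comm_ring, comm_monoid_mult}"
  assumes \<phi>: "poisson_hom fp_scale fp_bracket scale bracket \<phi>"
    and \<chi>: "poisson_hom fp_scale fp_bracket scale bracket \<chi>"
    and gen: "\<And>g. \<phi> (fp_gen g) = \<chi> (fp_gen g)"
  shows "\<phi> = \<chi>"
proof
  interpret \<phi>: module_hom fp_scale scale \<phi>
    using \<phi> by (simp add: poisson_hom_def linear_iff_module_hom)
  interpret \<chi>: module_hom fp_scale scale \<chi>
    using \<chi> by (simp add: poisson_hom_def linear_iff_module_hom)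
  have mult: "\<phi> (y * z) = \<phi> y * \<phi> z" "\<chi> (y * z) = \<chi> y * \<chi> z" "\<phi> 1 = 1" "\<chi> 1 = 1"
    and br: "\<phi> (fp_bracket y z) = bracket (\<phi> y) (\<phi> z)" "\<chi> (fp_bracket y z) = bracket (\<chi> y) (\<chi> z)" for y z
    using \<phi> \<chi> by (simp_all add: poisson_hom_def)
  have lie: "\<phi> (symbol 1 l) = \<chi> (symbol 1 l)" if "l \<in> free_lie" for l
    using that
  proof (induction rule: free_lie.induct)
    case (gen g)
    show ?case using assms(3)[of g] by (simp add: fp_gen_def)
  next
    case (comm a b)
    then show ?case
      by (simp add: symbol_bracket[OF free_lie_in_pbw free_lie_in_pbw] br)
  qed (simp_all add: symbol_add symbol_scale free_lie_in_pbw[unfolded One_nat_def] \<phi>.add \<chi>.add \<phi>.scale \<chi>.scale)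
  fix z
  show "\<phi> z = \<chi> z"
  proof (induction z rule: free_poisson_induct)
    case (symbol n a)
    then have "\<phi> (symbol n a) = \<chi> (symbol n a) \<and> a \<in> pbw n"
    proof (induction rule: pbw_induct)
      case (prod ls)
      then have "\<phi> (symbol n (prod_list ls)) = \<chi> (symbol n (prod_list ls))"
      proof (induction ls arbitrary: n)
        case Nil
        show ?case
        proof (cases n)
          case (Suc k)
          then show ?thesis by (simp add: symbol_pred one_in_pbw \<phi>.zero \<chi>.zero)
        qed (simp add: symbol_one mult)
      next
        case (Cons l ls)
        then obtain k where n: "n = 1 + k" by (cases n) auto
        have "symbol (1 + k) (l * prod_list ls) = symbol 1 l * symbol k (prod_list ls)"
          using Cons.prems n by (intro symbol_mult free_lie_in_pbw prod_list_in_pbw) auto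
        moreover have "\<phi> (symbol k (prod_list ls)) = \<chi> (symbol k (prod_list ls))"
          using Cons n by simp
        ultimately show ?case
          using lie[of l] Cons.prems n by (simp add: mult)
      qed
      with prod show ?case by (simp add: prod_list_in_pbw)
    qed (simp_all add: symbol_add symbol_scale \<phi>.add \<chi>.add \<phi>.scale \<chi>.scale pbw_closed)
    then show ?case ..
  qed (simp add: \<phi>.add \<chi>.add)
qed

context poisson_algebra
begin

definition graded_value :: "(gen \<Rightarrow> 'a) \<Rightarrow> 'k graded_tensor \<Rightarrow> 'a" where
  "graded_value e f = (\<Sum>n\<in>Poly_Mapping.keys f. top_value e n (component f n))"

lemma top_value_zero: "top_value e n 0 = 0"
  by (simp add: top_value_def pairing_zero)

lemma graded_value_superset:
  assumes "finite S" "Poly_Mapping.keys f \<subseteq> S"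
  shows "graded_value e f = (\<Sum>n\<in>S. top_value e n (component f n))"
  unfolding graded_value_def
  by (rule sum.mono_neutral_left) (use assms in \<open>auto simp: in_keys_iff top_value_zero\<close>)

lemma graded_value_add: "graded_value e (f + g) = graded_value e f + graded_value e g"
proof -
  let ?S = "Poly_Mapping.keys f \<union> Poly_Mapping.keys g"
  have S: "finite ?S" "Poly_Mapping.keys (f + g) \<subseteq> ?S" by (simp_all add: Poly_Mapping.keys_add)
  show ?thesis
    by (simp add: graded_value_superset[OF S] graded_value_superset[OF S(1)] lookup_add
      top_value_add sum.distrib)
qed

lemma graded_value_cong:
  assumes "gr_rel f g"
  shows "graded_value e f = graded_value e g"
proof -
  let ?S = "Poly_Mapping.keys f \<union> Poly_Mapping.keys g"
  have "top_value e n (component f n) = top_value e n (component g n)" for n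
    using top_value_pred[OF gr_relD(3)[OF assms, of n]]
    by (simp add: lookup_minus top_value_diff)
  then show ?thesis
    by (simp add: graded_value_superset[of ?S])
qed

definition graded_eval :: "(gen \<Rightarrow> 'a) \<Rightarrow> 'k free_poisson \<Rightarrow> 'a" where
  "graded_eval e z = graded_value e (rep_free_poisson z)"

lemma graded_eval_abs: "gr_rel f f \<Longrightarrow> graded_eval e (abs_free_poisson f) = graded_value e f"
  unfolding graded_eval_def by (intro graded_value_cong Quotient_rep_abs[OF Quotient_free_poisson])

lemma graded_eval_symbol: "a \<in> pbw n \<Longrightarrow> graded_eval e (symbol n a) = top_value e n a"
  unfolding symbol_def
  by (simp add: graded_eval_abs gr_rel_single graded_value_superset[of "{n}"])

lemma graded_eval_add: "graded_eval e (y + z) = graded_eval e y + graded_eval e z"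
proof -
  have "gr_rel (rep_free_poisson u) (rep_free_poisson u)" "abs_free_poisson (rep_free_poisson u) = u"
    for u :: "'k free_poisson"
    by (rule Quotient_rep_reflp[OF Quotient_free_poisson], rule Quotient_abs_rep[OF Quotient_free_poisson])
  then have "y + z = abs_free_poisson (rep_free_poisson y + rep_free_poisson z)"
      "gr_rel (rep_free_poisson y + rep_free_poisson z) (rep_free_poisson y + rep_free_poisson z)"
    using plus_free_poisson.abs_eq[of "rep_free_poisson y" "rep_free_poisson z"]
    by (simp_all add: gr_rel_add)
  then show ?thesis
    by (simp add: graded_eval_abs graded_value_add) (simp add: graded_eval_def)
qed

lemma graded_eval_scale: "graded_eval e (fp_scale c z) = scale c (graded_eval e z)"
proof (induction z rule: free_poisson_induct)
  case (symbol n a)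
  then show ?case
    using graded_eval_symbol[of "tscale c a" n e]
    by (simp add: symbol_scale graded_eval_symbol top_value_scale pbw_closed)
qed (simp add: fp.scale_right_distrib graded_eval_add scale_right_distrib)

lemma graded_eval_mult: "graded_eval e (y * z) = graded_eval e y * graded_eval e z"
proof (induction y rule: free_poisson_induct)
  case (symbol m a)
  note a = this
  show ?case
  proof (induction z rule: free_poisson_induct)
    case (symbol n b)
    have "graded_eval e (symbol m a * symbol n b) = graded_eval e (symbol (m + n) (a * b))"
      using a symbol by (simp add: symbol_mult)
    then show ?case
      using a symbol by (simp add: graded_eval_symbol pbw_mult top_value_mult)
  qed (simp add: distrib_left graded_eval_add)
qed (simp add: distrib_right graded_eval_add)

lemma bracket_top_value_0: "a \<in> pbw 0 \<Longrightarrow> bracket (top_value e 0 a) x = 0"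
  by (induction rule: pbw_induct)
    (simp_all add: top_value_one bracket_one_left top_value_add top_value_scale bracket_add_left bracket_scale_left)

lemma graded_eval_bracket: "graded_eval e (fp_bracket y z) = bracket (graded_eval e y) (graded_eval e z)"
proof (induction y rule: free_poisson_induct)
  case (symbol m a)
  note a = this
  show ?case
  proof (induction z rule: free_poisson_induct)
    case (symbol n b)
    show ?case
    proof (cases "m + n")
      case 0
      have "graded_eval e 0 = 0"
        using graded_eval_symbol[of 0 0 e] symbol_pred[of "0 :: 'k tensor" 0] by (simp add: pbw_closed top_value_zero)
      then show ?thesis
        using 0 a symbol by (simp add: bracket_symbol_0 graded_eval_symbol bracket_top_value_0)
    next
      case (Suc k)
      then have "comm a b \<in> pbw k" using pbw_comm[OF a symbol] by simp
      then have "graded_eval e (symbol k (comm a b)) = bracket (top_value e m a) (top_value e n b)"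
        using top_value_comm[OF a symbol Suc] by (simp add: graded_eval_symbol)
      then show ?thesis
        using symbol_bracket[OF a symbol Suc] a symbol by (simp add: graded_eval_symbol)
    qed
  qed (simp add: fp_bracket_add_right graded_eval_add bracket_add_right)
qed (simp add: fp_bracket_add_left graded_eval_add bracket_add_left)

lemma graded_eval_one: "graded_eval e 1 = 1"
  using graded_eval_symbol[OF one_in_pbw, of e 0] by (simp add: symbol_one top_value_one)

lemma graded_eval_gen: "graded_eval e (fp_gen g) = e g"
proof -
  have "pairing e (top_functional 1) [] (tgen g) [] = top_functional 1 ([] @ e g # [])"
    using represents_gen enveloping_functional_top unfolding represents_def by blast
  then have "top_value e 1 (tgen g) = e g"
    by (simp add: top_value_def top_functional_le)
  then show ?thesis
    by (simp add: fp_gen_def graded_eval_symbol[OF free_lie_in_pbw[OF free_lie.gen], simplified])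
qed

lemma poisson_hom_graded_eval: "poisson_hom fp_scale fp_bracket scale bracket (graded_eval e)"
proof -
  have "module_hom fp_scale scale (graded_eval e)"
    by (simp add: module_hom_iff fp.module_axioms module_axioms graded_eval_add graded_eval_scale)
  then show ?thesis
    by (simp add: poisson_hom_def linear_iff_module_hom graded_eval_one graded_eval_mult graded_eval_bracket)
qed

text \<open>
  The graded evaluation built from the functionals above is such a morphism, and it is the only one
  because the two generators generate; so the definite description has its intended meaning.
\<close>

theorem free_poisson_eval:
  shows poisson_hom_free_poisson_eval:
      "poisson_hom fp_scale fp_bracket scale bracket (free_poisson_eval scale bracket x y)"
    and free_poisson_eval_GX: "free_poisson_eval scale bracket x y (fp_gen GX) = x"
    and free_poisson_eval_GY: "free_poisson_eval scale bracket x y (fp_gen GY) = y"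
proof -
  let ?P = "\<lambda>\<phi>. poisson_hom fp_scale fp_bracket scale bracket \<phi> \<and> \<phi> (fp_gen GX) = x \<and> \<phi> (fp_gen GY) = y"
  have "\<exists>!\<phi>. ?P \<phi>"
  proof (rule ex1I[where a = "graded_eval (case_gen x y)"])
    show "?P (graded_eval (case_gen x y))"
      by (simp add: poisson_hom_graded_eval graded_eval_gen)
    fix \<phi> assume \<phi>: "?P \<phi>"
    show "\<phi> = graded_eval (case_gen x y)"
    proof (rule poisson_hom_eqI[OF conjunct1[OF \<phi>] poisson_hom_graded_eval])
      show "\<phi> (fp_gen g) = graded_eval (case_gen x y) (fp_gen g)" for g
        using \<phi> by (cases g) (simp_all add: graded_eval_gen)
    qed
  qed
  then have "?P (free_poisson_eval scale bracket x y)"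
    unfolding free_poisson_eval_def by (rule theI')
  then show "poisson_hom fp_scale fp_bracket scale bracket (free_poisson_eval scale bracket x y)"
    "free_poisson_eval scale bracket x y (fp_gen GX) = x"
    "free_poisson_eval scale bracket x y (fp_gen GY) = y" by auto
qed

end


section \<open>Jacobson's formula in the tensor algebra\<close>

text \<open>
  The derivative of \<open>c\<^sup>n\<close> in the direction \<open>a\<close>.
\<close>

definition power_sum :: "'r::ring_1 \<Rightarrow> 'r \<Rightarrow> nat \<Rightarrow> 'r" where
  "power_sum c a n = (\<Sum>j<n. c ^ (n - 1 - j) * a * c ^ j)"

lemma power_sum_Suc: "power_sum c a (Suc n) = c * power_sum c a n + a * c ^ n"
proof -
  have "c ^ (n - j) = c * c ^ (n - 1 - j)" if "j < n" for j
    using that by (simp flip: power_Suc add: Suc_diff_Suc)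
  then have "(\<Sum>j<n. c ^ (n - j) * a * c ^ j) = (\<Sum>j<n. c * (c ^ (n - 1 - j) * a * c ^ j))"
    by (intro sum.cong) (simp_all add: mult.assoc)
  then show ?thesis
    by (simp add: power_sum_def sum_distrib_left)
qed

lemma comm_power_sum: "comm c (power_sum c a n) = comm (c ^ n) a"
proof (induction n)
  case 0
  then show ?case by (simp add: power_sum_def comm_def)
next
  case (Suc n)
  have "comm c (power_sum c a (Suc n)) = c * comm c (power_sum c a n) + comm c a * c ^ n"
    by (simp add: power_sum_Suc comm_add_right comm_mult_right) (simp add: comm_def power_commutes)
  then show ?case
    by (simp add: Suc.IH) (simp add: comm_def algebra_simps)
qed

text \<open>
  The operator \<open>ad c\<close> is the difference of left and right multiplication by \<open>c\<close>, which commute with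
  each other.
\<close>

lemma comm_funpow_binomial:
  fixes a c :: "'r::ring_1"
  shows "(comm c ^^ n) a = (\<Sum>j\<le>n. of_int ((-1) ^ j * int (n choose j)) * (c ^ (n - j) * a * c ^ j))"
proof (induction n)
  case 0
  then show ?case by simp
next
  case (Suc n)
  define k :: "nat \<Rightarrow> 'r" where "k j = of_int ((-1) ^ j * int (n choose j))" for j
  define U where "U j = c ^ (Suc n - j) * a * c ^ j" for j
  have k_comm: "x * k j = k j * x" for x j
    unfolding k_def by (rule mult_of_int_commute[symmetric])
  have left: "c * (k j * (c ^ (n - j) * a * c ^ j)) = k j * U j" if "j \<le> n" for j
  proof -
    have "c * (k j * (c ^ (n - j) * a * c ^ j)) = k j * (c * c ^ (n - j) * a * c ^ j)"
      by (simp flip: mult.assoc add: k_comm)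
    then show ?thesis using that by (simp add: U_def Suc_diff_le)
  qed
  have right: "k j * (c ^ (n - j) * a * c ^ j) * c = k j * U (Suc j)" for j
    by (simp add: U_def mult.assoc power_commutes)
  have step: "k (Suc j) - k j = of_int ((-1) ^ Suc j * int (Suc n choose Suc j))" for j
  proof -
    have "k (Suc j) - k j = of_int ((-1) ^ Suc j * int (n choose Suc j) - (-1) ^ j * int (n choose j))"
      unfolding k_def of_int_diff ..
    also have "(-1) ^ Suc j * int (n choose Suc j) - (-1) ^ j * int (n choose j) =
        (-1) ^ Suc j * int (Suc n choose Suc j)"
      by (simp add: algebra_simps)
    finally show ?thesis .
  qed
  have "(comm c ^^ Suc n) a = (\<Sum>j\<le>n. k j * U j) - (\<Sum>j\<le>n. k j * U (Suc j))"
    unfolding funpow.simps o_apply Suc.IH k_def[symmetric] comm_def sum_distrib_left sum_distrib_right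
    by (simp add: left right)
  also have "(\<Sum>j\<le>n. k j * U j) = k 0 * U 0 + (\<Sum>j\<le>n. k (Suc j) * U (Suc j))"
  proof -
    have "(\<Sum>j\<le>n. k j * U j) = (\<Sum>j\<le>Suc n. k j * U j)" by (simp add: k_def binomial_eq_0)
    then show ?thesis by (simp only: sum.atMost_Suc_shift)
  qed
  also have "k 0 * U 0 + (\<Sum>j\<le>n. k (Suc j) * U (Suc j)) - (\<Sum>j\<le>n. k j * U (Suc j)) =
      k 0 * U 0 + (\<Sum>j\<le>n. (k (Suc j) - k j) * U (Suc j))"
    by (simp add: sum_subtractf left_diff_distrib)
  also have "\<dots> = (\<Sum>j\<le>Suc n. of_int ((-1) ^ j * int (Suc n choose j)) * U j)"
    unfolding sum.atMost_Suc_shift step by (simp add: k_def)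
  finally show ?case by (simp add: U_def)
qed

text \<open>
  By Pascal's rule two neighbouring entries of row \<open>p - 1\<close> add up to an inner entry of row \<open>p\<close>, which
  is divisible by \<open>p\<close>.
\<close>

lemma alternating_choose_pred_prime:
  assumes "prime p" and p: "of_nat p = (0 :: 'r::ring_1)" and "j < p"
  shows "(of_int ((-1) ^ j * int ((p - 1) choose j)) :: 'r) = 1"
  using assms(3)
proof (induction j)
  case 0
  then show ?case by simp
next
  case (Suc j)
  have "Suc (p - 1) = p" using Suc.prems by simp
  then have "p choose Suc j = ((p - 1) choose j) + ((p - 1) choose Suc j)"
    by (metis binomial_Suc_Suc)
  moreover have "p dvd (p choose Suc j)"
    using assms(1) Suc.prems by (intro dvd_choose_prime) auto
  then have "(of_nat (p choose Suc j) :: 'r) = 0"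
    using p by (auto elim!: dvdE)
  ultimately have "(of_nat ((p - 1) choose Suc j) :: 'r) = - of_nat ((p - 1) choose j)"
    by (simp add: eq_neg_iff_add_eq_0 add.commute)
  with Suc show ?case by simp
qed

lemma comm_funpow_pred_prime:
  fixes a c :: "'r::ring_1"
  assumes "prime p" "of_nat p = (0 :: 'r)"
  shows "(comm c ^^ (p - 1)) a = power_sum c a p"
proof -
  have "{..p - 1} = {..<p}" using prime_gt_0_nat[OF assms(1)] by auto
  then show ?thesis
    using alternating_choose_pred_prime[OF assms]
    by (simp add: comm_funpow_binomial power_sum_def)
qed

text \<open>
  The commutator of \<open>c\<close> with \<open>power_sum c a p\<close> telescopes.
\<close>

lemma comm_funpow_prime:
  fixes a c :: "'r::ring_1"
  assumes "prime p" "of_nat p = (0 :: 'r)"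
  shows "(comm c ^^ p) a = comm (c ^ p) a"
proof -
  have "(comm c ^^ Suc (p - 1)) a = comm (c ^ p) a"
    unfolding funpow.simps o_apply comm_funpow_pred_prime[OF assms] by (rule comm_power_sum)
  then show ?thesis using prime_gt_0_nat[OF assms(1)] by simp
qed

text \<open>
  The derivation \<open>t d/dt\<close> of \<open>T(V)[t]\<close>. It is used instead of \<open>d/dt\<close> because it does not
  shift degrees.
\<close>

definition euler :: "'k::field graded_tensor \<Rightarrow> 'k graded_tensor" where
  "euler f = Poly_Mapping.mapp (\<lambda>n x. of_nat n * x) f"

lemma component_euler: "component (euler f) n = of_nat n * component f n"
  by (simp add: euler_def lookup_mapp when_def in_keys_iff)

lemma euler_mult: "euler (f * g) = euler f * g + f * euler g"
proof (rule poly_mapping_eqI)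
  fix n
  have "of_nat n * (component f i * component g (n - i)) =
      of_nat i * component f i * component g (n - i) + component f i * (of_nat (n - i) * component g (n - i))"
    if "i \<le> n" for i
  proof -
    have "component f i * (of_nat (n - i) * component g (n - i)) =
        of_nat (n - i) * (component f i * component g (n - i))"
      by (metis mult.assoc mult_of_nat_commute)
    moreover have "(of_nat n :: 'a tensor) = of_nat i + of_nat (n - i)"
      using that by (simp flip: of_nat_add)
    ultimately show ?thesis by (simp add: distrib_right mult.assoc)
  qed
  then show "component (euler (f * g)) n = component (euler f * g + f * euler g) n"
    by (simp add: component_euler lookup_add component_mult sum_distrib_left flip: sum.distrib)
qed

text \<open>
  The element \<open>t a + b\<close> of \<open>T(V)[t]\<close>. The type \<open>graded_tensor\<close> serves as the ring of polynomials in a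
  central variable over the noncommutative ring \<open>T(V)\<close>.
\<close>

definition pencil :: "'k::field tensor \<Rightarrow> 'k tensor \<Rightarrow> 'k graded_tensor" where
  "pencil a b = Poly_Mapping.single 1 a + Poly_Mapping.single 0 b"

lemma euler_pencil: "euler (pencil a b) = Poly_Mapping.single 1 a"
  by (rule poly_mapping_eqI) (auto simp: component_euler pencil_def lookup_add lookup_single when_def)

lemma euler_pencil_power: "euler (pencil a b ^ n) = power_sum (pencil a b) (Poly_Mapping.single 1 a) n"
proof (induction n)
  case 0
  show ?case
    by (rule poly_mapping_eqI) (simp add: component_euler power_sum_def lookup_one when_def)
next
  case (Suc n)
  then show ?case
    by (simp add: euler_mult euler_pencil power_sum_Suc)
qed

lemma component_pencil_mult:
  "component (pencil a b * f) 0 = b * component f 0"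
  "component (pencil a b * f) (Suc n) = a * component f n + b * component f (Suc n)"
proof -
  show "component (pencil a b * f) 0 = b * component f 0"
    by (simp add: component_mult pencil_def lookup_add lookup_single)
  have "component (pencil a b * f) (Suc n) =
      b * component f (Suc n) + (a * component f n + (\<Sum>i<n. 0 :: 'a tensor))"
    unfolding component_mult sum.atMost_Suc_shift[of _ n]
    by (cases n) (simp_all add: pencil_def lookup_add lookup_single sum.atMost_Suc_shift when_def del: sum.atMost_Suc)
  then show "component (pencil a b * f) (Suc n) = a * component f n + b * component f (Suc n)"
    by simp
qed

lemma component_mult_pencil:
  "component (f * pencil a b) 0 = component f 0 * b"
  "component (f * pencil a b) (Suc n) = component f n * a + component f (Suc n) * b"
proof -
  show "component (f * pencil a b) 0 = component f 0 * b"
    by (simp add: component_mult pencil_def lookup_add lookup_single)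
  have "(\<Sum>i<n. component f i * component (pencil a b) (Suc n - i)) = 0"
    by (intro sum.neutral) (auto simp: pencil_def lookup_add lookup_single when_def)
  moreover have "{..Suc n} = insert (Suc n) (insert n {..<n})" by auto
  ultimately show "component (f * pencil a b) (Suc n) = component f n * a + component f (Suc n) * b"
    by (simp add: component_mult) (simp add: pencil_def lookup_add lookup_single when_def Suc_diff_le)
qed

lemma component_comm_pencil:
  "component (comm (pencil a b) f) 0 = comm b (component f 0)"
  "component (comm (pencil a b) f) (Suc n) = comm a (component f n) + comm b (component f (Suc n))"
  by (simp_all add: comm_def lookup_minus component_pencil_mult component_mult_pencil)

lemma coeff_ad_pencil:
  assumes "br x 0 = 0" "br y 0 = 0"
  shows "coeff (ad_pencil br x y f) 0 = br y (coeff f 0)"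
    "coeff (ad_pencil br x y f) (Suc n) = br x (coeff f n) + br y (coeff f (Suc n))"
  using assms by (simp_all add: ad_pencil_def coeff_map_poly)

text \<open>
  Iterated commutators with \<open>t a + b\<close>, computed in the ring \<open>T(V)[t]\<close>, have the coefficients that
  define the Jacobson polynomial. The shift by one degree comes from starting at \<open>t a\<close>.
\<close>

lemma component_comm_pencil_funpow:
  "component ((comm (pencil a b) ^^ k) (Poly_Mapping.single 1 a)) 0 = 0 \<and>
   component ((comm (pencil a b) ^^ k) (Poly_Mapping.single 1 a)) (Suc n) =
     coeff ((ad_pencil comm a b ^^ k) [:a:]) n"
proof (induction k arbitrary: n)
  case 0
  then show ?case by (cases n) (simp_all add: lookup_single)
next
  case (Suc k)
  have zero: "comm u (0 :: 'a tensor) = 0" for u by (simp add: comm_def)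
  show ?case
    using Suc by (cases n) (simp_all add: component_comm_pencil coeff_ad_pencil zero)
qed

lemma of_nat_tensor: "(of_nat n :: 'k::field tensor) = tscalar (of_nat n)"
  by (induction n) (simp_all add: tscalar_add)

lemma of_nat_graded_tensor: "(of_nat n :: 'k::field graded_tensor) = Poly_Mapping.single 0 (of_nat n)"
  by (induction n) (simp_all add: single_add)

lemma pencil_power_components:
  "component (pencil a b ^ n) 0 = b ^ n" "component (pencil a b ^ n) n = a ^ n"
  "(\<Sum>i\<le>n. component (pencil a b ^ n) i) = (a + b) ^ n"
proof -
  have high: "component (pencil a b ^ n) i = 0" if "n < i" for i n
    using that
  proof (induction n arbitrary: i)
    case 0
    then show ?case by (simp add: lookup_one)
  next
    case (Suc n)
    then obtain j where "i = Suc j" by (cases i) auto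
    with Suc show ?case by (simp add: component_pencil_mult)
  qed
  show "component (pencil a b ^ n) 0 = b ^ n"
    by (induction n) (simp_all add: lookup_one component_pencil_mult)
  show "component (pencil a b ^ n) n = a ^ n"
    by (induction n) (simp_all add: lookup_one component_pencil_mult high)
  show "(\<Sum>i\<le>n. component (pencil a b ^ n) i) = (a + b) ^ n"
  proof (induction n)
    case 0
    then show ?case by (simp add: lookup_one)
  next
    case (Suc n)
    let ?f = "component (pencil a b ^ n)"
    have "(\<Sum>i\<le>Suc n. component (pencil a b ^ Suc n) i) =
        b * ?f 0 + (\<Sum>i\<le>n. a * ?f i + b * ?f (Suc i))"
      unfolding sum.atMost_Suc_shift by (simp add: component_pencil_mult)
    also have "\<dots> = a * (\<Sum>i\<le>n. ?f i) + b * (?f 0 + (\<Sum>i\<le>n. ?f (Suc i)))"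
      by (simp add: sum.distrib sum_distrib_left distrib_left)
    also have "?f 0 + (\<Sum>i\<le>n. ?f (Suc i)) = (\<Sum>i\<le>n. ?f i)"
      by (metis add.right_neutral high lessI sum.atMost_Suc sum.atMost_Suc_shift)
    finally show ?case by (simp add: Suc.IH distrib_right)
  qed
qed

text \<open>
  Let \<open>c = t a + b\<close>. Differentiating \<open>c\<^sup>p\<close> gives \<open>power_sum c (t a) p = (ad c)\<^sup>p\<^sup>-\<^sup>1 (t a)\<close> in
  characteristic \<open>p\<close>, hence \<open>i\<close> times the coefficient of \<open>t\<^sup>i\<close> in \<open>c\<^sup>p\<close> is the \<open>i\<close>-th
  Jacobson term. For \<open>0 < i < p\<close> one may divide by \<open>i\<close>; the extreme coefficients are \<open>b\<^sup>p\<close> and \<open>a\<^sup>p\<close>,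
  and setting \<open>t = 1\<close> gives the formula.
\<close>

theorem jacobson_formula:
  fixes a b :: "'k::field tensor"
  assumes p: "prime p" "CHAR('k) = p"
  shows "(a + b) ^ p = a ^ p + b ^ p + jacobson_Lambda p tscale comm a b"
proof -
  let ?c = "pencil a b"
  have [simp]: "(of_nat p :: 'k) = 0" using p(2) of_nat_CHAR by metis
  have "(of_nat p :: 'k graded_tensor) = 0"
    by (simp add: of_nat_graded_tensor of_nat_tensor)
  then have "euler (?c ^ p) = (comm ?c ^^ (p - 1)) (Poly_Mapping.single 1 a)"
    unfolding euler_pencil_power by (rule comm_funpow_pred_prime[OF p(1), symmetric])
  then have s: "of_nat i * component (?c ^ p) i = jacobson_s p comm i a b" if "0 < i" for i
    using that component_euler[of "?c ^ p" i] component_comm_pencil_funpow[where a = a and b = b and k = "p - 1" and n = "i - 1"]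
    by (simp add: jacobson_s_def)
  have "tscale (inverse (of_nat i)) (jacobson_s p comm i a b) = component (?c ^ p) i"
    if "i \<in> {1..p - 1}" for i
  proof -
    have i: "0 < i" "i < p" using that by auto
    then have "(of_nat i :: 'k) \<noteq> 0"
      using p(2) by (simp add: of_nat_eq_0_iff_char_dvd nat_dvd_not_less)
    then show ?thesis
      by (simp flip: s[OF i(1)] tscalar_mult mult.assoc add: tscale_def of_nat_tensor)
  qed
  then have "jacobson_Lambda p tscale comm a b = (\<Sum>i = 1..p - 1. component (?c ^ p) i)"
    by (simp add: jacobson_Lambda_def)
  moreover have "{..p} = insert 0 (insert p {1..p - 1})" "p > 0"
    using prime_gt_0_nat[OF p(1)] by auto
  then have "(\<Sum>i\<le>p. component (?c ^ p) i) =
      b ^ p + (a ^ p + (\<Sum>i = 1..p - 1. component (?c ^ p) i))"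
    by (simp add: pencil_power_components)
  ultimately show ?thesis by (simp add: pencil_power_components add_ac)
qed


section \<open>The quantized polynomial in terms of the Jacobson polynomial\<close>

lemma (in lie_algebra) jacobson_Lambda_commuting:
  assumes "bracket x y = 0" "p \<ge> 2"
  shows "jacobson_Lambda p scale bracket x y = 0"
proof -
  have "bracket y x = 0" using assms(1) bracket_skew[of y x] by simp
  then have "coeff (ad_pencil bracket x y [:x:]) n = 0" for n
    by (cases n; cases "n - 1") (simp_all add: coeff_ad_pencil bracket_zero_right bracket_self)
  then have "ad_pencil bracket x y [:x:] = 0" by (intro poly_eqI) simp
  moreover have "(ad_pencil bracket x y ^^ n) 0 = 0" for n
    by (induction n) (simp_all add: ad_pencil_def)
  moreover have "p - 1 = Suc (p - 2)" using assms(2) by simp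
  ultimately have "(ad_pencil bracket x y ^^ (p - 1)) [:x:] = 0"
    by (simp only: funpow_Suc_right o_apply)
  then show ?thesis by (simp add: jacobson_Lambda_def jacobson_s_def)
qed

lemma poisson_hom_jacobson_Lambda:
  assumes hom: "poisson_hom scaleA bracketA scaleB bracketB \<phi>"
    and "lie_algebra scaleA bracketA" "lie_algebra scaleB bracketB"
  shows "\<phi> (jacobson_Lambda p scaleA bracketA x y) = jacobson_Lambda p scaleB bracketB (\<phi> x) (\<phi> y)"
proof -
  interpret A: lie_algebra scaleA bracketA by fact
  interpret B: lie_algebra scaleB bracketB by fact
  interpret \<phi>: module_hom scaleA scaleB \<phi>
    using hom by (simp add: poisson_hom_def linear_iff_module_hom)
  have br: "\<phi> (bracketA u v) = bracketB (\<phi> u) (\<phi> v)" for u v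
    using hom by (simp add: poisson_hom_def)
  have "\<phi> (coeff ((ad_pencil bracketA x y ^^ k) [:x:]) i) =
      coeff ((ad_pencil bracketB (\<phi> x) (\<phi> y) ^^ k) [:\<phi> x:]) i" for k i
  proof (induction k arbitrary: i)
    case 0
    show ?case by (cases i) (simp_all add: \<phi>.zero)
  next
    case (Suc k)
    then show ?case
      by (cases i) (simp_all add: coeff_ad_pencil A.bracket_zero_right B.bracket_zero_right \<phi>.add br)
  qed
  then show ?thesis
    by (simp add: jacobson_Lambda_def jacobson_s_def \<phi>.sum \<phi>.scale)
qed

lemma symbol_sum:
  assumes "finite S" "\<And>i. i \<in> S \<Longrightarrow> f i \<in> pbw n"
  shows "symbol n (\<Sum>i\<in>S. f i) = (\<Sum>i\<in>S. symbol n (f i))"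
  using assms
proof (induction S)
  case empty
  then show ?case by (simp add: symbol_pred pbw_closed)
next
  case (insert i S)
  then show ?case by (simp add: symbol_add pbw_closed)
qed

text \<open>
  Each of the \<open>p - 1\<close> commutators with an element of \<open>F\<^sub>m\<^sub>+\<^sub>1\<close> raises the filtration degree by \<open>m\<close> only,
  and on symbols it is the Poisson bracket.
\<close>

lemma symbol_jacobson_Lambda:
  fixes a b :: "'k::field tensor" and p :: nat
  assumes a: "a \<in> pbw (Suc m)" and b: "b \<in> pbw (Suc m)"
  defines "n \<equiv> Suc m + (p - 1) * m"
  shows "jacobson_Lambda p tscale comm a b \<in> pbw n"
    and "symbol n (jacobson_Lambda p tscale comm a b) =
      jacobson_Lambda p fp_scale fp_bracket (symbol (Suc m) a) (symbol (Suc m) b)"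
proof -
  define c where "c k i = coeff ((ad_pencil comm a b ^^ k) [:a:]) i" for k i
  define d where "d k i =
    coeff ((ad_pencil fp_bracket (symbol (Suc m) a) (symbol (Suc m) b) ^^ k) [:symbol (Suc m) a:]) i" for k i
  have zero: "comm u (0 :: 'k tensor) = 0" for u by (simp add: comm_def)
  have c: "c k i \<in> pbw (Suc m + k * m) \<and> symbol (Suc m + k * m) (c k i) = d k i" for k i
  proof (induction k arbitrary: i)
    case 0
    show ?case using a by (cases i) (simp_all add: c_def d_def symbol_pred pbw_closed)
  next
    case (Suc k)
    have comm: "comm u (c k j) \<in> pbw (Suc m + Suc k * m)"
      "symbol (Suc m + Suc k * m) (comm u (c k j)) = fp_bracket (symbol (Suc m) u) (d k j)"
      if "u \<in> pbw (Suc m)" for u j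
    proof -
      have eq: "Suc m + (Suc m + k * m) = Suc (Suc m + Suc k * m)" by simp
      show "comm u (c k j) \<in> pbw (Suc m + Suc k * m)"
        using pbw_comm[OF that conjunct1[OF Suc.IH[of j]]] unfolding eq by simp
      show "symbol (Suc m + Suc k * m) (comm u (c k j)) = fp_bracket (symbol (Suc m) u) (d k j)"
        using symbol_bracket[OF that conjunct1[OF Suc.IH[of j]] eq] Suc.IH[of j] by simp
    qed
    show ?case
    proof (cases i)
      case 0
      then have "c (Suc k) i = comm b (c k 0)" "d (Suc k) i = fp_bracket (symbol (Suc m) b) (d k 0)"
        by (simp_all add: c_def d_def coeff_ad_pencil zero fp.bracket_zero_right)
      then show ?thesis using comm[OF b] by simp
    next
      case (Suc j)
      then have "c (Suc k) i = comm a (c k j) + comm b (c k i)"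
        "d (Suc k) i = fp_bracket (symbol (Suc m) a) (d k j) + fp_bracket (symbol (Suc m) b) (d k i)"
        by (simp_all add: c_def d_def coeff_ad_pencil zero fp.bracket_zero_right)
      then show ?thesis
        using comm[OF a, of j] comm[OF b, of i] by (simp add: symbol_add pbw_closed del: mult_Suc)
    qed
  qed
  have \<Lambda>: "jacobson_Lambda p tscale comm a b =
      (\<Sum>i = 1..p - 1. tscale (inverse (of_nat i)) (c (p - 1) (i - 1)))"
    by (simp add: jacobson_Lambda_def jacobson_s_def c_def)
  show "jacobson_Lambda p tscale comm a b \<in> pbw n"
    unfolding \<Lambda> n_def using c by (intro tens.subspace_sum tens.subspace_scale subspace_pbw) simp
  show "symbol n (jacobson_Lambda p tscale comm a b) =
      jacobson_Lambda p fp_scale fp_bracket (symbol (Suc m) a) (symbol (Suc m) b)"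
    unfolding \<Lambda> n_def using c[of "p - 1"]
    by (subst symbol_sum)
      (simp_all add: symbol_scale jacobson_Lambda_def jacobson_s_def d_def pbw_closed)
qed

lemma pbw_power: "a \<in> pbw m \<Longrightarrow> a ^ n \<in> pbw (n * m)"
  by (induction n) (simp_all add: one_in_pbw pbw_mult)

lemma symbol_power: "a \<in> pbw m \<Longrightarrow> symbol (n * m) (a ^ n) = symbol m a ^ n"
  by (induction n) (simp_all add: symbol_one symbol_mult pbw_power)

lemma tscale_power: "tscale c a ^ n = tscale (c ^ n) (a ^ n)"
  by (induction n) (simp_all add: tscale_mult_left tscale_mult_right mult.commute)

lemma two_power_char:
  assumes "prime p" "CHAR('k::field) = p"
  shows "(2 :: 'k) ^ p = 2"
proof -
  have "(1 + 1 :: 'k) ^ p = 1 ^ p + 1 ^ p"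
    by (rule freshmans_dream) (simp_all add: assms)
  then show ?thesis by simp
qed

lemma pbw_subset: "a \<in> pbw m \<Longrightarrow> m \<le> n \<Longrightarrow> a \<in> pbw n"
  using pbw_mono by blast

lemma symbol_low: "a \<in> pbw m \<Longrightarrow> m < n \<Longrightarrow> symbol n a = 0"
  by (rule symbol_pred) (cases n, auto intro: pbw_subset)

text \<open>
  In characteristic \<open>p\<close> the commutator with \<open>a\<^sup>p\<close> is \<open>(ad a)\<^sup>p\<close>, and \<open>ad a\<close> preserves \<open>F\<^sub>1\<close> for
  \<open>a \<in> F\<^sub>1\<close>, likewise for \<open>b\<close>. So \<open>[a, b\<^sup>p] = - (ad b)\<^sup>p a\<close> lies in \<open>F\<^sub>1\<close>, and the
  remaining \<open>p - 1\<close> applications of \<open>ad a\<close> stay in \<open>F\<^sub>1\<close>;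
  the filtration alone would only give \<open>F\<^sub>2\<^sub>p\<^sub>-\<^sub>1\<close>.
\<close>

lemma comm_powers_in_pbw:
  fixes a b :: "'k::field tensor"
  assumes p: "prime p" "CHAR('k) = p" and a: "a \<in> pbw 1" and b: "b \<in> pbw 1"
  shows "comm (a ^ p) (b ^ p) \<in> pbw 1"
proof -
  have char: "(of_nat p :: 'k tensor) = 0"
    using p(2) of_nat_CHAR[where 'a = 'k] by (simp add: of_nat_tensor)
  have ad: "comm u v \<in> pbw 1" if "u \<in> pbw 1" "v \<in> pbw 1" for u v :: "'k tensor"
    using pbw_comm[OF that] by simp
  have iter: "(comm u ^^ n) v \<in> pbw 1" if "u \<in> pbw 1" "v \<in> pbw 1" for u v :: "'k tensor" and n
    using that by (induction n) (auto simp del: One_nat_def intro: ad)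
  have skew: "comm u v = - comm v u" for u v :: "'k tensor" by (simp add: comm_def)
  have "comm (b ^ p) a \<in> pbw 1"
    unfolding comm_funpow_prime[OF p(1) char, symmetric] by (rule iter[OF b a])
  then have *: "comm a (b ^ p) \<in> pbw 1"
    using skew[of a "b ^ p"] by (simp add: pbw_closed)
  have "comm (a ^ p) (b ^ p) = (comm a ^^ (p - 1)) (comm a (b ^ p))"
    unfolding comm_funpow_prime[OF p(1) char, symmetric]
    using prime_gt_0_nat[OF p(1)] by (simp flip: funpow_Suc_right[THEN fun_cong, unfolded o_apply])
  then show ?thesis using iter[OF a *] by simp
qed

lemma fp_gen_power: "tgen g ^ n \<in> pbw n" "symbol n (tgen g ^ n) = fp_gen g ^ n"
  using pbw_power[where n = n, OF free_lie_in_pbw[OF free_lie.gen[of g]]]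
    symbol_power[where n = n, OF free_lie_in_pbw[OF free_lie.gen[of g]]]
  by (simp_all add: fp_gen_def)

text \<open>
  This is the leading term of Jacobson's formula, whose correction lies in \<open>F\<^sub>1\<close>. Evaluation
  turns it into additivity of \<open>p\<close>-th powers in every Poisson algebra over the field.
\<close>

lemma fp_gen_add_power:
  assumes p: "prime p" "CHAR('k::field) = p"
  shows "(fp_gen GX + fp_gen GY :: 'k free_poisson) ^ p = fp_gen GX ^ p + fp_gen GY ^ p"
proof -
  let ?X = "tgen GX :: 'k tensor" and ?Y = "tgen GY :: 'k tensor"
  have X: "?X \<in> pbw 1" and Y: "?Y \<in> pbw 1" by (auto intro: free_lie_in_pbw free_lie.gen simp del: One_nat_def)
  have "p > 1" using p(1) prime_gt_1_nat by blast
  then have "symbol p (jacobson_Lambda p tscale comm ?X ?Y) = 0"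
    using symbol_jacobson_Lambda(1)[of ?X 0 ?Y p] X Y by (intro symbol_low[of _ 1]) simp_all
  moreover have "jacobson_Lambda p tscale comm ?X ?Y \<in> pbw p"
    using symbol_jacobson_Lambda(1)[of ?X 0 ?Y p] X Y \<open>p > 1\<close> pbw_subset[of _ 1 p] by simp
  ultimately have "symbol p ((?X + ?Y) ^ p) = symbol p (?X ^ p) + symbol p (?Y ^ p)"
    unfolding jacobson_formula[OF p] by (simp add: symbol_add fp_gen_power pbw_closed)
  moreover have "symbol p ((?X + ?Y) ^ p) = (symbol 1 ?X + symbol 1 ?Y) ^ p"
    using symbol_power[of "?X + ?Y" 1 p] X Y by (simp add: symbol_add pbw_closed del: One_nat_def)
  ultimately show ?thesis by (simp add: fp_gen_power) (simp add: fp_gen_def)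
qed

text \<open>
  Jacobson's formula turns \<open>((X + Y)\<^sup>2)\<^sup>p = ((X + Y)\<^sup>p)\<^sup>2\<close> into an expression for
  \<open>2 ((X Y)\<^sup>p - X\<^sup>p Y\<^sup>p)\<close>, using \<open>(X + Y)\<^sup>2 = (X\<^sup>2 + Y\<^sup>2) + (2 X Y + [Y, X])\<close>. The term \<open>[Y, X]\<close>
  has degree 1 and does not affect symbols in degree 2. What remains are the commutators
  that order the factors of \<open>(X\<^sup>p + Y\<^sup>p + \<Lambda>)\<^sup>2\<close>, the square \<open>\<Lambda>\<^sup>2\<close> and \<open>[Y, X]\<^sup>p\<close>, which all lie
  in \<open>F\<^sub>p\<close>.
\<close>

theorem two_quantized_P:
  fixes p :: nat
  assumes p: "prime p" "CHAR('k::field) = p" and p3: "p \<ge> 3"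
  defines "x \<equiv> fp_gen GX :: 'k free_poisson" and "y \<equiv> fp_gen GY"
  defines "\<Lambda> \<equiv> jacobson_Lambda p (fp_scale :: 'k \<Rightarrow> _) fp_bracket"
  shows "fp_scale 2 (quantized_P p) =
    fp_scale 2 ((x ^ p + y ^ p) * \<Lambda> x y) - \<Lambda> (x * x) (y * y) - \<Lambda> (x * x + y * y) (fp_scale 2 (x * y))"
proof -
  define X Y :: "'k tensor" where "X = tgen GX" and "Y = tgen GY"
  define L where "L = jacobson_Lambda p tscale (comm :: 'k tensor \<Rightarrow> _)"
  have X: "X \<in> pbw 1" and Y: "Y \<in> pbw 1"
    unfolding X_def Y_def by (auto intro: free_lie_in_pbw free_lie.gen simp del: One_nat_def)
  have x: "symbol 1 X = x" and y: "symbol 1 Y = y"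
    by (simp_all add: x_def y_def X_def Y_def fp_gen_def)
  have Xp: "X ^ p \<in> pbw p" "symbol p (X ^ p) = x ^ p" and Yp: "Y ^ p \<in> pbw p" "symbol p (Y ^ p) = y ^ p"
    by (simp_all add: X_def Y_def x_def y_def fp_gen_power)
  have two: "1 + 1 = (2 :: nat)" by simp
  note prods = pbw_mult[OF X X] pbw_mult[OF Y Y] pbw_mult[OF X Y] pbw_mult[OF Y X]
  note prods' = prods[unfolded two]
  note symbols = symbol_mult[OF X X] symbol_mult[OF Y Y] symbol_mult[OF X Y] symbol_mult[OF Y X]
  note symbols' = symbols[unfolded two x y]
  define D where "D = (X * Y) ^ p - X ^ p * Y ^ p"
  define C where "C = comm Y X"
  have C: "C \<in> pbw 1" using pbw_comm[OF Y X] by (simp add: C_def)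
  define L0 where "L0 = L X Y"
  define L1 where "L1 = L (X * X) (Y * Y)"
  define L2 where "L2 = L (X * X + Y * Y) (tscale 2 (X * Y) + C)"
  define L3 where "L3 = L (tscale 2 (X * Y)) C"
  have twice: "tscale 2 u = u + u" for u :: "'k tensor"
    using tens.scale_left_distrib[of 1 1 u] by simp
  have jac: "(a + b) ^ p = a ^ p + b ^ p + L a b" for a b :: "'k tensor"
    unfolding L_def by (rule jacobson_formula[OF p])
  have square: "(u * u) ^ p = u ^ p * u ^ p" for u :: "'k tensor"
    by (metis power2_eq_square power_even_eq power_mult mult.commute)
  have "(X + Y) * (X + Y) = (X * X + Y * Y) + (tscale 2 (X * Y) + C)"
    by (simp add: C_def comm_def twice algebra_simps)
  then have "(X + Y) ^ p * (X + Y) ^ p = ((X * X + Y * Y) + (tscale 2 (X * Y) + C)) ^ p"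
    by (simp flip: square)
  also have "\<dots> = X ^ p * X ^ p + Y ^ p * Y ^ p + L1 + (tscale 2 ((X * Y) ^ p) + C ^ p + L3) + L2"
    unfolding jac L1_def L2_def L3_def tscale_power two_power_char[OF p] square ..
  finally have "tscale 2 D = tscale 2 ((X ^ p + Y ^ p) * L0) - L1 - L2
      - (L3 + C ^ p + comm (X ^ p) L0 + comm (Y ^ p) L0 - comm (Y ^ p) (X ^ p) - L0 * L0)"
    unfolding jac L0_def[symmetric] twice D_def comm_def by (simp add: algebra_simps)
  moreover have L0: "L0 \<in> pbw 1" "symbol 1 L0 = \<Lambda> x y"
    using symbol_jacobson_Lambda[of X 0 Y p] X Y x y by (simp_all add: L0_def L_def \<Lambda>_def)
  have L: "L a b \<in> pbw (p + 1)" "symbol (p + 1) (L a b) = \<Lambda> (symbol 2 a) (symbol 2 b)"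
    if "a \<in> pbw 2" "b \<in> pbw 2" for a b
  proof -
    have eq: "Suc 1 + (p - 1) * 1 = p + 1" using p3 by simp
    show "L a b \<in> pbw (p + 1)" "symbol (p + 1) (L a b) = \<Lambda> (symbol 2 a) (symbol 2 b)"
      using symbol_jacobson_Lambda[of a 1 b p] that unfolding eq
      by (simp_all add: L_def \<Lambda>_def numeral_2_eq_2)
  qed
  have C2: "C \<in> pbw 2" "symbol 2 C = 0"
    using C by (auto intro: pbw_subset symbol_low)
  have L1: "L1 \<in> pbw (p + 1)" "symbol (p + 1) L1 = \<Lambda> (x * x) (y * y)"
    using L[OF prods'(1,2)] symbols' by (simp_all add: L1_def)
  have L2: "L2 \<in> pbw (p + 1)" "symbol (p + 1) L2 = \<Lambda> (x * x + y * y) (fp_scale 2 (x * y))"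
    using L[of "X * X + Y * Y" "tscale 2 (X * Y) + C"] prods' C2 symbols'
    by (simp_all add: L2_def symbol_add symbol_scale pbw_closed)
  \<comment> \<open>The symbol of \<open>L3\<close> in degree \<open>p + 1\<close> is \<open>\<Lambda> (2 x y) 0\<close>.\<close>
  have "\<Lambda> z 0 = 0" for z
    unfolding \<Lambda>_def using p3 by (intro fp.jacobson_Lambda_commuting fp.bracket_zero_right) simp
  then have L3: "L3 \<in> pbw (p + 1)" "symbol (p + 1) L3 = 0"
    using L[of "tscale 2 (X * Y)" C] prods' C2 by (simp_all add: L3_def pbw_closed)
  define R where "R = C ^ p + comm (X ^ p) L0 + comm (Y ^ p) L0 - comm (Y ^ p) (X ^ p) - L0 * L0"
  have R: "R \<in> pbw p"
  proof -
    have "C ^ p \<in> pbw p" using pbw_power[OF C, of p] by simp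
    moreover have "comm (X ^ p) L0 \<in> pbw p" "comm (Y ^ p) L0 \<in> pbw p"
      using pbw_comm[OF Xp(1) L0(1)] pbw_comm[OF Yp(1) L0(1)] by simp_all
    moreover have "comm (Y ^ p) (X ^ p) \<in> pbw p"
      using comm_powers_in_pbw[OF p Y X] p3 by (auto intro: pbw_subset)
    moreover have "L0 * L0 \<in> pbw p"
      using pbw_mult[OF L0(1) L0(1)] p3 by (auto intro: pbw_subset)
    ultimately show ?thesis by (simp add: R_def pbw_closed)
  qed
  then have R': "R \<in> pbw (p + 1)" "symbol (p + 1) R = 0"
    by (auto intro: pbw_subset symbol_low)
  have M: "(X ^ p + Y ^ p) * L0 \<in> pbw (p + 1)"
      "symbol (p + 1) ((X ^ p + Y ^ p) * L0) = (x ^ p + y ^ p) * \<Lambda> x y"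
    using pbw_mult[of "X ^ p + Y ^ p" p L0 1] symbol_mult[of "X ^ p + Y ^ p" p L0 1] Xp Yp L0
    by (simp_all add: symbol_add pbw_closed)
  ultimately have D2: "tscale 2 D = tscale 2 ((X ^ p + Y ^ p) * L0) - L1 - L2 - (L3 + R)"
    by (simp add: R_def algebra_simps)
  have "(2 :: 'k) \<noteq> 0"
    using of_nat_eq_0_iff_char_dvd[of 2, where 'a = 'k] p(2) p3 by (auto dest: dvd_imp_le)
  then have "D = tscale (inverse 2) (tscale 2 D)" by simp
  moreover have "tscale 2 D \<in> pbw (p + 1)"
    unfolding D2 by (intro pbw_closed M L1 L2 L3 R')
  ultimately have "D \<in> pbw (p + 1)"
    by (metis tens.subspace_scale subspace_pbw)
  then have "fp_scale 2 (quantized_P p) = symbol (p + 1) (tscale 2 D)"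
    by (simp add: quantized_P_def D_def X_def Y_def symbol_scale)
  also have "\<dots> = fp_scale 2 ((x ^ p + y ^ p) * \<Lambda> x y) - \<Lambda> (x * x) (y * y)
      - \<Lambda> (x * x + y * y) (fp_scale 2 (x * y))"
    unfolding D2 using M L1 L2 L3 R'
    by (simp add: symbol_add symbol_diff symbol_scale pbw_closed)
  finally show ?thesis .
qed

context poisson_algebra
begin

theorem two_quantized_P_at:
  assumes p: "prime p" "CHAR('k) = p" and p3: "p \<ge> 3"
  defines "\<Lambda> \<equiv> jacobson_Lambda p scale bracket"
  shows "scale 2 (quantized_P_at p scale bracket x y) =
      scale 2 ((x ^ p + y ^ p) * \<Lambda> x y) - \<Lambda> (x * x) (y * y) - \<Lambda> (x * x + y * y) (scale 2 (x * y))"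
    and add_power_char: "(x + y) ^ p = x ^ p + y ^ p"
proof -
  let ?\<phi> = "free_poisson_eval scale bracket x y"
  note hom = poisson_hom_free_poisson_eval[of x y]
  interpret \<phi>: module_hom fp_scale scale ?\<phi>
    using hom by (simp add: poisson_hom_def linear_iff_module_hom)
  have mult: "?\<phi> 1 = 1" "?\<phi> (u * v) = ?\<phi> u * ?\<phi> v" for u v
    using hom by (simp_all add: poisson_hom_def)
  have power: "?\<phi> (u ^ n) = ?\<phi> u ^ n" for u n
    by (induction n) (simp_all add: mult)
  have \<Lambda>: "?\<phi> (jacobson_Lambda p fp_scale fp_bracket u v) = \<Lambda> (?\<phi> u) (?\<phi> v)" for u v
    unfolding \<Lambda>_def
    by (rule poisson_hom_jacobson_Lambda[OF hom fp.lie_algebra_axioms lie_algebra_axioms])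
  note gens = free_poisson_eval_GX free_poisson_eval_GY
  show "scale 2 (quantized_P_at p scale bracket x y) =
      scale 2 ((x ^ p + y ^ p) * \<Lambda> x y) - \<Lambda> (x * x) (y * y) - \<Lambda> (x * x + y * y) (scale 2 (x * y))"
    using arg_cong[OF two_quantized_P[OF p p3], of ?\<phi>]
    by (simp add: quantized_P_at_def \<phi>.scale \<phi>.add \<phi>.diff mult power \<Lambda> gens)
  show "(x + y) ^ p = x ^ p + y ^ p"
    using arg_cong[OF fp_gen_add_power[OF p], of ?\<phi>] by (simp add: \<phi>.add power gens)
qed

end


section \<open>The two definitions of a restricted Poisson algebra\<close>

theorem lemma3p7:
  fixes p :: nat
    and scale :: "'k::field \<Rightarrow> 'a::{comm_ring, comm_monoid_mult} \<Rightarrow> 'a"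
    and bracket :: "'a \<Rightarrow> 'a \<Rightarrow> 'a"
    and pmap :: "'a \<Rightarrow> 'a"
  assumes "CHAR('k) = p" and "p \<ge> 3"
    and "weakly_restricted_poisson_algebra scale bracket p pmap"
  shows "(\<forall>x. pmap (x ^ 2) = scale 2 (x ^ p * pmap x)) \<longleftrightarrow>
         (\<forall>x y. pmap (x * y) = x ^ p * pmap y + y ^ p * pmap x + quantized_P_at p scale bracket x y)"
    (is "?square \<longleftrightarrow> ?product")
proof -
  interpret weakly_restricted_poisson_algebra scale bracket p pmap by fact
  have prime: "prime p"
    using assms(1,2) prime_CHAR_semidom[where 'a = 'k] by simp
  note P = two_quantized_P_at[OF prime assms(1,2)] and freshman = add_power_char[OF prime assms(1,2)]
  define \<Lambda> where "\<Lambda> = jacobson_Lambda p scale bracket"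
  have "(2 :: 'k) \<noteq> 0"
    using of_nat_eq_0_iff_char_dvd[of 2, where 'a = 'k] assms(1,2) by (auto dest: dvd_imp_le)
  then have cancel: "u = v" if "scale 2 u = scale 2 v" for u v
    using that by simp
  have twice: "scale 2 u = u + u" for u
    using scale_left_distrib[of 1 1 u] by simp
  show ?thesis
  proof
    assume square: ?square
    show ?product
    proof (intro allI)
      fix x y
      have sq: "pmap (u * u) = scale 2 (u ^ p * pmap u)" for u
        using square by (simp add: power2_eq_square)
      have "(x + y) * (x + y) = (x * x + y * y) + scale 2 (x * y)"
        by (simp add: twice algebra_simps)
      then have "pmap ((x + y) * (x + y)) =
          pmap (x * x) + pmap (y * y) + \<Lambda> (x * x) (y * y) + scale 2 (pmap (x * y))
          + \<Lambda> (x * x + y * y) (scale 2 (x * y))"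
        by (simp add: pmap_add pmap_scale \<Lambda>_def two_power_char[OF prime assms(1)])
      moreover have "pmap ((x + y) * (x + y)) = scale 2 ((x ^ p + y ^ p) * (pmap x + pmap y + \<Lambda> x y))"
        by (simp add: sq freshman pmap_add \<Lambda>_def)
      ultimately have "scale 2 (pmap (x * y)) =
          scale 2 (x ^ p * pmap y + y ^ p * pmap x + quantized_P_at p scale bracket x y)"
        using P[of x y, folded \<Lambda>_def]
        by (simp add: sq scale_right_distrib distrib_left distrib_right) (simp add: algebra_simps)
      then show "pmap (x * y) = x ^ p * pmap y + y ^ p * pmap x + quantized_P_at p scale bracket x y"
        by (rule cancel)
    qed
  next
    assume product: ?product
    show ?square
    proof
      fix x
      have "\<Lambda> u v = 0" if "bracket u v = 0" for u v
        unfolding \<Lambda>_def using that assms(2) by (intro jacobson_Lambda_commuting) simp_all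
      then have "scale 2 (quantized_P_at p scale bracket x x) = 0"
        using P[of x x, folded \<Lambda>_def]
        by (simp add: twice bracket_self bracket_add_left bracket_add_right)
      then have "quantized_P_at p scale bracket x x = 0"
        using cancel[of _ 0] by simp
      then show "pmap (x ^ 2) = scale 2 (x ^ p * pmap x)"
        using product by (simp add: power2_eq_square twice)
    qed
  qed
qed

end
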